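(* Let $d\ge 1$ and $n\ge 2$ be integers, and let $M=(m_{i,j})$ be a $d\times d$ integer matrix of infinite order (i.e. $M^k\neq I$ for all $k\ge 1$) whose determinant $m$ is relatively prime to $n$. Then there exists a (finite) invertible automaton $A$ over an alphabet with $n^d$ letters such that the group $G(A)$ is isomorphic to the ascending HNN extension $$G_M=\langle\, a_1,\dots,a_d,t \mid a_ia_j=a_ja_i\ (1\le i,j\le d),\ \ t a_i t^{-1}=a_1^{m_{1,i}}a_2^{m_{2,i}}\cdots a_d^{m_{d,i}}\ (1\le i\le d)\,\rangle .$$
   Context: An automaton is a quadruple $A=(Q,X,\rho,\tau)$ with $Q$ a finite set (states), $X$ a finite set (alphabet), and functions $\rho:Q\times X\to X$ (rewriting) and $\tau:Q\times X\to Q$ (transition). It is invertible if for every $q\in Q$ the map $\rho_q:X\to X$, $x\mapsto\rho(q,x)$, is a permutation. Each state $q$ of an invertible automaton defines an automorphism, also denoted $q$, of the rooted tree $X^*$ of finite words over $X$ (equivalently a transformation of the infinite words over $X$), recursively by $q(\emptyset)=\emptyset$ and $q(xw)=\rho(q,x)\,q_x(w)$, where $q_x=\tau(q,x)$, for $x\in X$ and $w$ a word. The group of the automaton, $G(A)$, is the subgroup of $\mathrm{Aut}(X^* )$ generated by the automorphisms defined by all states $q\in Q$. *)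

theory Defs
  imports
    "Jordan_Normal_Form.Determinant"
    "HOL-Algebra.Bij"
    "HOL-Algebra.Generated_Groups"
begin

section \<open>Automata and the groups they generate\<close>

record ('q, 'x) automaton =
  states :: "'q set"
  alphabet :: "'x set"
  rewriting :: "'q \<Rightarrow> 'x \<Rightarrow> 'x"
  transition :: "'q \<Rightarrow> 'x \<Rightarrow> 'q"

locale automaton =
  fixes A :: "('q, 'x) automaton"
  assumes finite_states: "finite (states A)"
    and finite_alphabet: "finite (alphabet A)"
    and rewriting_closed: "rewriting A \<in> states A \<rightarrow> alphabet A \<rightarrow> alphabet A"
    and transition_closed: "transition A \<in> states A \<rightarrow> alphabet A \<rightarrow> states A"

locale invertible_automaton = automaton +
  assumes rewriting_bij: "q \<in> states A \<Longrightarrow> bij_betw (rewriting A q) (alphabet A) (alphabet A)"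

fun action :: "('q, 'x) automaton \<Rightarrow> 'q \<Rightarrow> 'x list \<Rightarrow> 'x list" where
  "action A q [] = []"
| "action A q (x # w) = rewriting A q x # action A (transition A q x) w"

text \<open>
  The tree of finite words over \<open>X\<close> has the vertex set \<open>lists X\<close>, the root \<open>[]\<close>, and an edge
  from \<open>w\<close> to \<open>w @ [x]\<close> for all \<open>w \<in> lists X\<close> and \<open>x \<in> X\<close>.
\<close>

definition is_child :: "'x set \<Rightarrow> 'x list \<Rightarrow> 'x list \<Rightarrow> bool" where
  "is_child X v w \<longleftrightarrow> (\<exists>x\<in>X. v = w @ [x])"

definition tree_automorphisms :: "'x set \<Rightarrow> ('x list \<Rightarrow> 'x list) set" where
  "tree_automorphisms X =
    {f \<in> Bij (lists X). f [] = [] \<and>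
       (\<forall>v\<in>lists X. \<forall>w\<in>lists X. is_child X (f v) (f w) \<longleftrightarrow> is_child X v w)}"

definition tree_Aut :: "'x set \<Rightarrow> ('x list \<Rightarrow> 'x list) monoid" where
  "tree_Aut X = BijGroup (lists X)\<lparr>carrier := tree_automorphisms X\<rparr>"

text \<open>
  Elements of \<^const>\<open>Bij\<close> are extensional, so the action of a state is restricted to words over
  the alphabet. \<^const>\<open>subgroup_generated\<close> ignores generators outside of the carrier; that there
  are none here is the lemma \<open>restrict_action_in_tree_Aut\<close> below.
\<close>

definition automaton_group :: "('q, 'x) automaton \<Rightarrow> ('x list \<Rightarrow> 'x list) monoid" where
  "automaton_group A =
    subgroup_generated (tree_Aut (alphabet A))
      ((\<lambda>q. restrict (action A q) (lists (alphabet A))) ` states A)"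

lemma tree_automorphismsI:
  assumes "f \<in> Bij (lists X)" "f [] = []"
    and "\<And>v w. v \<in> lists X \<Longrightarrow> w \<in> lists X \<Longrightarrow> is_child X (f v) (f w) \<longleftrightarrow> is_child X v w"
  shows "f \<in> tree_automorphisms X"
  unfolding tree_automorphisms_def using assms by blast

lemma tree_automorphismsD:
  assumes "f \<in> tree_automorphisms X"
  shows "f \<in> Bij (lists X)" "f [] = []"
    and "\<And>v w. v \<in> lists X \<Longrightarrow> w \<in> lists X \<Longrightarrow> is_child X (f v) (f w) \<longleftrightarrow> is_child X v w"
    and "\<And>v. v \<in> lists X \<Longrightarrow> f v \<in> lists X"
  using assms Bij_imp_funcset[of f "lists X"] unfolding tree_automorphisms_def by blast+

lemma subgroup_tree_automorphisms: "subgroup (tree_automorphisms X) (BijGroup (lists X))"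
proof (rule subgroup.intro)
  show "tree_automorphisms X \<subseteq> carrier (BijGroup (lists X))"
    by (auto simp: BijGroup_def dest: tree_automorphismsD(1))
  have "(\<lambda>w\<in>lists X. w) \<in> tree_automorphisms X"
    by (rule tree_automorphismsI[OF id_Bij]) (simp_all only: restrict_apply' lists.Nil)
  then show "\<one>\<^bsub>BijGroup (lists X)\<^esub> \<in> tree_automorphisms X"
    by (simp add: BijGroup_def)
next
  fix f g
  assume f: "f \<in> tree_automorphisms X" and g: "g \<in> tree_automorphisms X"
  note f' = tree_automorphismsD[OF f] and g' = tree_automorphismsD[OF g]
  have "compose (lists X) f g \<in> tree_automorphisms X"
    by (rule tree_automorphismsI[OF compose_Bij[OF f'(1) g'(1)]])
       (simp_all only: compose_eq lists.Nil f' g')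
  then show "f \<otimes>\<^bsub>BijGroup (lists X)\<^esub> g \<in> tree_automorphisms X"
    using f'(1) g'(1) by (simp add: BijGroup_def)
next
  fix f
  assume f: "f \<in> tree_automorphisms X"
  note f' = tree_automorphismsD[OF f]
  let ?g = "inv_into (lists X) f"
  have bij: "bij_betw f (lists X) (lists X)" using f'(1) by (simp add: Bij_def)
  have g: "?g v \<in> lists X" "f (?g v) = v" if "v \<in> lists X" for v
    using Bij_inv_into_mem[OF f'(1) that] bij_betw_inv_into_right[OF bij that] .
  have "restrict ?g (lists X) \<in> tree_automorphisms X"
  proof (rule tree_automorphismsI[OF restrict_inv_into_Bij[OF f'(1)]])
    show "restrict ?g (lists X) [] = []"
      using bij_betw_inv_into_left[OF bij lists.Nil] f'(2) by simp
  next
    fix v w assume vw: "v \<in> lists X" "w \<in> lists X"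
    show "is_child X (restrict ?g (lists X) v) (restrict ?g (lists X) w) \<longleftrightarrow> is_child X v w"
      using f'(3)[OF g(1)[OF vw(1)] g(1)[OF vw(2)]]
      by (simp only: g(2) vw restrict_apply' simp_thms)
  qed
  then show "inv\<^bsub>BijGroup (lists X)\<^esub> f \<in> tree_automorphisms X"
    by (simp only: inv_BijGroup[OF f'(1)])
qed

lemma group_tree_Aut: "group (tree_Aut X)"
  unfolding tree_Aut_def
  by (rule subgroup.subgroup_is_group[OF subgroup_tree_automorphisms group_BijGroup])

lemma length_action [simp]: "length (action A q w) = length w"
  by (induction w arbitrary: q) auto

context invertible_automaton
begin

lemma action_closed: "q \<in> states A \<Longrightarrow> w \<in> lists (alphabet A) \<Longrightarrow> action A q w \<in> lists (alphabet A)"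
proof (induction w arbitrary: q)
  case (Cons x w)
  then have "transition A q x \<in> states A" "rewriting A q x \<in> alphabet A"
    using rewriting_closed transition_closed by auto
  then show ?case using Cons by auto
qed simp

lemma action_inj:
  "\<lbrakk>q \<in> states A; v \<in> lists (alphabet A); w \<in> lists (alphabet A); action A q v = action A q w\<rbrakk>
    \<Longrightarrow> v = w"
proof (induction v arbitrary: q w)
  case Nil
  then show ?case by (cases w) auto
next
  case (Cons x v)
  then obtain y u where w: "w = y # u" by (cases w) auto
  have "x = y"
    using Cons.prems w rewriting_bij[of q] by (auto simp: bij_betw_def inj_on_def)
  moreover have "transition A q x \<in> states A"
    using Cons.prems transition_closed by auto
  ultimately show ?case using Cons.IH[of "transition A q x" u] Cons.prems w by auto
qed

lemma action_surj:
  "\<lbrakk>q \<in> states A; w \<in> lists (alphabet A)\<rbrakk> \<Longrightarrow> w \<in> action A q ` lists (alphabet A)"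
proof (induction w arbitrary: q)
  case (Cons y w)
  have "y \<in> rewriting A q ` alphabet A"
    using Cons.prems rewriting_bij[of q] by (simp add: bij_betw_def)
  then obtain x where x: "x \<in> alphabet A" "rewriting A q x = y" by blast
  have "transition A q x \<in> states A"
    using Cons.prems x transition_closed by auto
  moreover have "w \<in> lists (alphabet A)" using Cons.prems by simp
  ultimately have "w \<in> action A (transition A q x) ` lists (alphabet A)" by (rule Cons.IH)
  then obtain v where v: "w = action A (transition A q x) v" "v \<in> lists (alphabet A)"
    by (rule imageE)
  have "y # w = action A q (x # v)" by (simp only: action.simps x(2) v(1))
  moreover have "x # v \<in> lists (alphabet A)" using x(1) v(2) by simp
  ultimately show ?case by (rule image_eqI)
next
  case Nil
  have "[] = action A q []" by simp
  then show ?case by (rule image_eqI) simp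
qed

lemma action_snoc:
  "\<lbrakk>q \<in> states A; w \<in> lists (alphabet A); x \<in> alphabet A\<rbrakk>
    \<Longrightarrow> \<exists>y\<in>alphabet A. action A q (w @ [x]) = action A q w @ [y]"
proof (induction w arbitrary: q)
  case Nil
  then show ?case using rewriting_closed by auto
next
  case (Cons z w)
  then have "transition A q z \<in> states A" using transition_closed by auto
  then show ?case using Cons by auto
qed

lemma restrict_action_in_tree_Aut:
  assumes q: "q \<in> states A"
  shows "restrict (action A q) (lists (alphabet A)) \<in> carrier (tree_Aut (alphabet A))"
proof -
  let ?X = "alphabet A"
  have "bij_betw (action A q) (lists ?X) (lists ?X)"
  proof (rule bij_betw_imageI)
    show "inj_on (action A q) (lists ?X)" using action_inj[OF q] by (rule inj_onI)
    show "action A q ` lists ?X = lists ?X"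
      using action_surj[OF q] action_closed[OF q] by blast
  qed
  then have B: "restrict (action A q) (lists ?X) \<in> Bij (lists ?X)"
    by (simp add: Bij_def)
  have "is_child ?X (action A q v) (action A q w) \<longleftrightarrow> is_child ?X v w"
    if v: "v \<in> lists ?X" and w: "w \<in> lists ?X" for v w
  proof
    assume "is_child ?X v w"
    then show "is_child ?X (action A q v) (action A q w)"
      using action_snoc[OF q w] by (auto simp: is_child_def)
  next
    assume "is_child ?X (action A q v) (action A q w)"
    then obtain y where y: "action A q v = action A q w @ [y]"
      by (auto simp: is_child_def)
    then have "length v = Suc (length w)"
      by (metis length_action length_append_singleton)
    then obtain u x where u: "v = u @ [x]"
      by (metis length_Suc_conv_rev)
    then have ux: "u \<in> lists ?X" "x \<in> ?X" using v by auto
    then obtain z where "action A q v = action A q u @ [z]"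
      using action_snoc[OF q] u by blast
    then have "u = w" using y action_inj[OF q ux(1) w] by simp
    then show "is_child ?X v w" using u ux by (auto simp: is_child_def)
  qed
  then have "restrict (action A q) (lists ?X) \<in> tree_automorphisms ?X"
    by (intro tree_automorphismsI[OF B]) (simp_all only: restrict_apply' lists.Nil action.simps)
  then show ?thesis by (simp add: tree_Aut_def)
qed

end

lemma group_automaton_group: "group (automaton_group A)"
  unfolding automaton_group_def by (rule group.group_subgroup_generated[OF group_tree_Aut])


section \<open>Group presentations\<close>

text \<open>
  A letter \<open>(s, True)\<close> stands for the generator \<open>s\<close>, and \<open>(s, False)\<close> for its inverse. The group
  presented by the generators \<open>S\<close> and the relations \<open>l = r\<close> for \<open>(l, r) \<in> R\<close> consists of the words
  over \<open>S\<close> and its formal inverses, modulo the least congruence that contains the free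
  cancellations and the relations.
\<close>

type_synonym 'g word = "('g \<times> bool) list"

definition words :: "'g set \<Rightarrow> 'g word set" where
  "words S = lists (S \<times> UNIV)"

inductive word_cong :: "'g set \<Rightarrow> ('g word \<times> 'g word) set \<Rightarrow> 'g word \<Rightarrow> 'g word \<Rightarrow> bool"
  for S R where
  refl: "w \<in> words S \<Longrightarrow> word_cong S R w w"
| sym: "word_cong S R v w \<Longrightarrow> word_cong S R w v"
| trans: "word_cong S R u v \<Longrightarrow> word_cong S R v w \<Longrightarrow> word_cong S R u w"
| cancel: "\<lbrakk>s \<in> S; u \<in> words S; v \<in> words S\<rbrakk>
    \<Longrightarrow> word_cong S R (u @ [(s, b), (s, \<not> b)] @ v) (u @ v)"
| relation: "\<lbrakk>(l, r) \<in> R; l \<in> words S; r \<in> words S; u \<in> words S; v \<in> words S\<rbrakk>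
    \<Longrightarrow> word_cong S R (u @ l @ v) (u @ r @ v)"

definition word_rel :: "'g set \<Rightarrow> ('g word \<times> 'g word) set \<Rightarrow> ('g word \<times> 'g word) set" where
  "word_rel S R = {(v, w). word_cong S R v w}"

definition presented_group :: "'g set \<Rightarrow> ('g word \<times> 'g word) set \<Rightarrow> 'g word set monoid" where
  "presented_group S R =
    \<lparr>carrier = words S // word_rel S R,
     mult = (\<lambda>C D. \<Union>u\<in>C. \<Union>v\<in>D. word_rel S R `` {u @ v}),
     one = word_rel S R `` {[]}\<rparr>"

lemma words_append [simp]: "u @ v \<in> words S \<longleftrightarrow> u \<in> words S \<and> v \<in> words S"
  by (auto simp: words_def)

lemma words_Nil [simp]: "[] \<in> words S"
  by (simp add: words_def)

lemma words_Cons [simp]: "(s, b) # w \<in> words S \<longleftrightarrow> s \<in> S \<and> w \<in> words S"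
  by (auto simp: words_def)

lemma word_cong_in_words: "word_cong S R v w \<Longrightarrow> v \<in> words S \<and> w \<in> words S"
  by (induction rule: word_cong.induct) auto

lemma equiv_word_rel: "equiv (words S) (word_rel S R)"
proof (rule equivI)
  show "word_rel S R \<subseteq> words S \<times> words S"
    using word_cong_in_words by (fastforce simp: word_rel_def)
  show "refl_on (words S) (word_rel S R)"
    by (simp add: refl_on_def word_rel_def word_cong.refl)
  show "sym (word_rel S R)"
    by (rule symI) (simp add: word_rel_def word_cong.sym)
  show "trans (word_rel S R)"
    unfolding word_rel_def by (rule transI) (blast intro: word_cong.trans)
qed

lemma word_cong_context:
  "word_cong S R v w \<Longrightarrow> x \<in> words S \<Longrightarrow> y \<in> words S \<Longrightarrow> word_cong S R (x @ v @ y) (x @ w @ y)"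
proof (induction rule: word_cong.induct)
  case (refl w)
  then show ?case by (simp add: word_cong.refl)
next
  case (sym v w)
  then show ?case by (simp add: word_cong.sym)
next
  case (trans u v w)
  then show ?case by (metis word_cong.trans)
next
  case (cancel s u v b)
  then show ?case using word_cong.cancel[of s S "x @ u" "v @ y" R b] by simp
next
  case (relation l r u v)
  then show ?case using word_cong.relation[of l r R S "x @ u" "v @ y"] by simp
qed

lemma word_cong_append:
  assumes "word_cong S R u u'" "word_cong S R v v'"
  shows "word_cong S R (u @ v) (u' @ v')"
proof -
  have "word_cong S R (u @ v) (u' @ v)"
    using word_cong_context[OF assms(1), of "[]" v] word_cong_in_words[OF assms(2)] by simp
  moreover have "word_cong S R (u' @ v) (u' @ v')"
    using word_cong_context[OF assms(2), of u' "[]"] word_cong_in_words[OF assms(1)] by simp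
  ultimately show ?thesis by (rule word_cong.trans)
qed

lemma presented_group_mult:
  assumes "u \<in> words S" "v \<in> words S"
  shows "word_rel S R `` {u} \<otimes>\<^bsub>presented_group S R\<^esub> word_rel S R `` {v} = word_rel S R `` {u @ v}"
proof -
  have "congruent2 (word_rel S R) (word_rel S R) (\<lambda>u v. word_rel S R `` {u @ v})"
  proof (rule congruent2I')
    fix u u' v v'
    assume "(u, u') \<in> word_rel S R" "(v, v') \<in> word_rel S R"
    then have "(u @ v, u' @ v') \<in> word_rel S R"
      by (simp add: word_rel_def word_cong_append)
    then show "word_rel S R `` {u @ v} = word_rel S R `` {u' @ v'}"
      by (rule equiv_class_eq[OF equiv_word_rel])
  qed
  from UN_equiv_class2[OF equiv_word_rel equiv_word_rel this assms]
  show ?thesis by (simp add: presented_group_def)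
qed

lemma word_cong_inverse:
  "w \<in> words S \<Longrightarrow> word_cong S R (rev (map (\<lambda>(s, b). (s, \<not> b)) w) @ w) []"
proof (induction w)
  case Nil
  then show ?case by (simp add: word_cong.refl)
next
  case (Cons a w)
  obtain s b where a: "a = (s, b)" by (cases a)
  let ?i = "rev (map (\<lambda>(s, b). (s, \<not> b)) w)"
  have s: "s \<in> S" and w: "w \<in> words S" using Cons.prems a by auto
  have i: "?i \<in> words S" using w by (auto simp: words_def)
  have "word_cong S R (?i @ [(s, \<not> b), (s, \<not> \<not> b)] @ w) (?i @ w)"
    by (rule word_cong.cancel[OF s i w])
  from word_cong.trans[OF this Cons.IH[OF w]] show ?case by (simp add: a)
qed

lemma carrier_presented_group:
  "C \<in> carrier (presented_group S R) \<longleftrightarrow> (\<exists>w\<in>words S. C = word_rel S R `` {w})"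
  by (auto simp: presented_group_def quotient_def)

lemma group_presented_group: "group (presented_group S R)"
proof (rule groupI)
  show "\<one>\<^bsub>presented_group S R\<^esub> \<in> carrier (presented_group S R)"
    by (simp add: presented_group_def quotientI)
next
  fix C D assume "C \<in> carrier (presented_group S R)" "D \<in> carrier (presented_group S R)"
  then obtain v w where "v \<in> words S" "C = word_rel S R `` {v}" "w \<in> words S" "D = word_rel S R `` {w}"
    by (auto simp: carrier_presented_group)
  then show "C \<otimes>\<^bsub>presented_group S R\<^esub> D \<in> carrier (presented_group S R)"
    unfolding carrier_presented_group
    by (intro bexI[of _ "v @ w"]) (simp_all add: presented_group_mult)
next
  fix C D E
  assume "C \<in> carrier (presented_group S R)" "D \<in> carrier (presented_group S R)"
    "E \<in> carrier (presented_group S R)"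
  then obtain u v w where "u \<in> words S" "C = word_rel S R `` {u}"
    "v \<in> words S" "D = word_rel S R `` {v}" "w \<in> words S" "E = word_rel S R `` {w}"
    by (auto simp: carrier_presented_group)
  then show "C \<otimes>\<^bsub>presented_group S R\<^esub> D \<otimes>\<^bsub>presented_group S R\<^esub> E
      = C \<otimes>\<^bsub>presented_group S R\<^esub> (D \<otimes>\<^bsub>presented_group S R\<^esub> E)"
    by (simp add: presented_group_mult)
next
  fix C assume "C \<in> carrier (presented_group S R)"
  then obtain w where w: "w \<in> words S" "C = word_rel S R `` {w}"
    by (auto simp: carrier_presented_group)
  have one: "\<one>\<^bsub>presented_group S R\<^esub> = word_rel S R `` {[]}"
    by (simp add: presented_group_def)
  show "\<one>\<^bsub>presented_group S R\<^esub> \<otimes>\<^bsub>presented_group S R\<^esub> C = C"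
    using w by (simp add: one presented_group_mult)
  let ?i = "rev (map (\<lambda>(s, b). (s, \<not> b)) w)"
  have i: "?i \<in> words S" using w by (auto simp: words_def)
  have "word_rel S R `` {?i} \<otimes>\<^bsub>presented_group S R\<^esub> C = \<one>\<^bsub>presented_group S R\<^esub>"
    using w i word_cong_inverse[OF w(1), of R]
    by (simp add: one presented_group_mult)
       (rule equiv_class_eq[OF equiv_word_rel], simp add: word_rel_def)
  moreover have "word_rel S R `` {?i} \<in> carrier (presented_group S R)"
    using i by (simp add: presented_group_def quotientI)
  ultimately show "\<exists>D\<in>carrier (presented_group S R).
      D \<otimes>\<^bsub>presented_group S R\<^esub> C = \<one>\<^bsub>presented_group S R\<^esub>" by blast
qed


section \<open>The ascending HNN extension of a free abelian group by an integer matrix\<close>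

text \<open>The generators \<open>a\<^sub>1, \<dots>, a\<^sub>d\<close> are \<open>Base 0, \<dots>, Base (d - 1)\<close>, and \<open>t\<close> is \<open>Stable\<close>.\<close>

datatype hnn_gen = Base nat | Stable

definition gen_power :: "'g \<Rightarrow> int \<Rightarrow> 'g word" where
  "gen_power s k = replicate (nat \<bar>k\<bar>) (s, 0 \<le> k)"

definition hnn_gens :: "nat \<Rightarrow> hnn_gen set" where
  "hnn_gens d = Base ` {..<d} \<union> {Stable}"

definition hnn_relations :: "nat \<Rightarrow> int mat \<Rightarrow> (hnn_gen word \<times> hnn_gen word) set" where
  "hnn_relations d M =
    {([(Base i, True), (Base j, True)], [(Base j, True), (Base i, True)]) | i j. i < d \<and> j < d} \<union>
    {([(Stable, True), (Base i, True), (Stable, False)],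
      concat (map (\<lambda>j. gen_power (Base j) (M $$ (j, i))) [0..<d])) | i. i < d}"

definition hnn_group :: "nat \<Rightarrow> int mat \<Rightarrow> hnn_gen word set monoid" where
  "hnn_group d M = presented_group (hnn_gens d) (hnn_relations d M)"

lemma hnn_relations_words: "hnn_relations d M \<subseteq> words (hnn_gens d) \<times> words (hnn_gens d)"
  by (auto simp: hnn_relations_def hnn_gens_def words_def gen_power_def)

end

(*
  Split Z_n^d into base-n digit vectors, n^d letters.  The first digit of M x + v is
  (M x_0 + v) mod n, and the carry (M x_0 + v) div n is again a translation vector, so that the maps
  x -> M x + v are the states of an automaton.  If r bounds the absolute row sums of M, the box
  -r <= v_i < r is closed under carries, which makes the automaton finite; it is invertible since
  det M is a unit modulo n.  The states generate the same group as t : x -> M x and the unit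
  translations a_i, and these satisfy the relations of G_M.  Conversely every element of G_M
  has the form t^-p a^v t^q; if it acts trivially, then M^q x + v = M^p x modulo every power of n,
  hence v = 0 and M^q = M^p, and p = q because M is nonsingular of infinite order.
*)
theory Submission
  imports Defs "HOL-Number_Theory.Cong" "HOL-Library.Countable_Set"
begin

section \<open>Homomorphisms from presented groups\<close>

text \<open>A tree automorphism is a function on finite words, so the n-adic map x -> B x + v is
  never available as such. It is replaced by its residues: on words of length k the claim is a
  congruence modulo n^k between integer vectors (\<open>realizes\<close>). This relation is faithful
  in both directions: \<open>realizes_unique\<close> lets equations in the tree group be checked on
  the parameters (B, v), and \<open>realizes_determines\<close> recovers the integer parameters from
  the automorphism. The matrix M need not be invertible over the integers, so t^-1 may have no
  integer parameters. Negative powers of t are therefore kept on the left, where they can be cleared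
  before two maps are compared. The consequences of the relations are derived once, in the locale
  \<open>hnn_target\<close>, for an arbitrary group with elements that satisfy them. Instantiated
  with the presented group it yields normal forms of the elements of G_M; instantiated with the tree
  group it provides the homomorphism whose kernel is tested on these normal forms.\<close>

primrec word_value :: "('a, 'b) monoid_scheme \<Rightarrow> ('g \<Rightarrow> 'a) \<Rightarrow> 'g word \<Rightarrow> 'a" where
  "word_value G f [] = \<one>\<^bsub>G\<^esub>"
| "word_value G f (x # w) =
    (if snd x then f (fst x) else inv\<^bsub>G\<^esub> f (fst x)) \<otimes>\<^bsub>G\<^esub> word_value G f w"

text \<open>The factors are multiplied in list order, so that the right-hand side of the conjugation
  relation, a concatenation of \<open>gen_power\<close> words, evaluates to such a product before
  any commutativity is known.\<close>

primrec power_prod :: "('a, 'b) monoid_scheme \<Rightarrow> ('i \<Rightarrow> 'a) \<Rightarrow> ('i \<Rightarrow> int) \<Rightarrow> 'i list \<Rightarrow> 'a" where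
  "power_prod G a u [] = \<one>\<^bsub>G\<^esub>"
| "power_prod G a u (j # js) = a j [^]\<^bsub>G\<^esub> u j \<otimes>\<^bsub>G\<^esub> power_prod G a u js"

lemma power_prod_cong:
  assumes "js = js'" "\<And>j. j \<in> set js' \<Longrightarrow> a j [^]\<^bsub>G\<^esub> u j = a' j [^]\<^bsub>G\<^esub> u' j"
  shows "power_prod G a u js = power_prod G a' u' js'"
  using assms(2) unfolding assms(1) by (induction js') auto

context group
begin

lemma word_value_closed:
  assumes "f \<in> S \<rightarrow> carrier G" "w \<in> words S"
  shows "word_value G f w \<in> carrier G"
  using assms(2)
proof (induction w)
  case (Cons x w)
  then have "f (fst x) \<in> carrier G" using assms(1) by (auto simp: words_def)
  then show ?case using Cons by (simp add: words_def)
qed simp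

lemma word_value_append:
  assumes "f \<in> S \<rightarrow> carrier G" "u \<in> words S" "v \<in> words S"
  shows "word_value G f (u @ v) = word_value G f u \<otimes> word_value G f v"
  using assms(2)
proof (induction u)
  case Nil
  then show ?case using word_value_closed[OF assms(1,3)] by simp
next
  case (Cons x u)
  then have "fst x \<in> S" and u: "u \<in> words S" by (auto simp: words_def)
  then have x: "f (fst x) \<in> carrier G" using assms(1) by auto
  show ?case
    using Cons.IH[OF u] x word_value_closed[OF assms(1) u] word_value_closed[OF assms(1,3)]
    by (simp add: m_assoc)
qed

text \<open>The core of the universal property: neither free cancellations nor relations are visible
  after evaluation, so evaluation descends to congruence classes.\<close>

lemma word_value_cong:
  assumes f: "f \<in> S \<rightarrow> carrier G"
    and R: "\<And>l r. (l, r) \<in> R \<Longrightarrow> word_value G f l = word_value G f r"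
    and "word_cong S R v w"
  shows "word_value G f v = word_value G f w"
  using assms(3)
proof (induction rule: word_cong.induct)
  case (cancel s u v b)
  then have "f s \<in> carrier G" using f by auto
  then have "word_value G f [(s, b), (s, \<not> b)] = \<one>" by simp
  with cancel show ?case
    by (simp only: word_value_append[OF f] words_append words_Cons words_Nil)
      (simp add: word_value_closed[OF f])
next
  case (relation l r u v)
  then show ?case by (simp add: word_value_append[OF f] R)
qed simp_all

lemma word_value_gen_power:
  assumes "f s \<in> carrier G"
  shows "word_value G f (gen_power s k) = f s [^] k"
proof -
  have "word_value G f (replicate m (s, b)) = (if b then f s else inv f s) [^] m" for m b
  proof (induction m)
    case (Suc m)
    have "(if b then f s else inv f s) \<in> carrier G" using assms by simp
    from nat_pow_Suc2[OF this, of m] show ?case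
      by (simp only: replicate_Suc word_value.simps fst_conv snd_conv Suc.IH)
  qed simp
  then have *: "word_value G f (gen_power s k) = (if 0 \<le> k then f s else inv f s) [^] nat \<bar>k\<bar>"
    by (simp only: gen_power_def)
  show ?thesis
  proof (cases "0 \<le> k")
    case True
    then show ?thesis by (simp only: * if_True abs_of_nonneg pow_nat)
  next
    case False
    then have "k < 0" "\<bar>k\<bar> = - k" by simp_all
    then show ?thesis
      using False assms by (simp only: * if_False nat_pow_inv int_pow_def2 if_True)
  qed
qed

lemma gen_power_in_words: "s \<in> S \<Longrightarrow> gen_power s k \<in> words S"
  by (auto simp: gen_power_def words_def)

lemma word_value_concat_gen_power:
  assumes f: "f \<in> S \<rightarrow> carrier G" and "\<And>j. j \<in> set js \<Longrightarrow> h j \<in> S"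
  shows "word_value G f (concat (map (\<lambda>j. gen_power (h j) (u j)) js)) = power_prod G (\<lambda>j. f (h j)) u js"
  using assms(2)
proof (induction js)
  case (Cons j js)
  then have "f (h j) \<in> carrier G" "gen_power (h j) (u j) \<in> words S"
    using f by (auto intro!: gen_power_in_words)
  moreover have "concat (map (\<lambda>j. gen_power (h j) (u j)) js) \<in> words S"
    using Cons.prems by (force simp: words_def gen_power_def)
  ultimately show ?case
    using Cons by (simp add: word_value_append[OF f] word_value_gen_power)
qed simp

lemma word_value_in_generate:
  assumes "w \<in> words S"
  shows "word_value G f w \<in> generate G (f ` S)"
  using assms
proof (induction w)
  case (Cons x w)
  then have "fst x \<in> S" "word_value G f w \<in> generate G (f ` S)" by (auto simp: words_def)
  then show ?case by (auto intro!: generate.eng intro: generate.incl generate.inv)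
qed (simp add: generate.one)

lemma generate_eq_word_values:
  assumes f: "f \<in> S \<rightarrow> carrier G"
  shows "generate G (f ` S) = word_value G f ` words S"
proof
  show "word_value G f ` words S \<subseteq> generate G (f ` S)"
    using word_value_in_generate by auto
  show "generate G (f ` S) \<subseteq> word_value G f ` words S"
  proof
    fix x assume "x \<in> generate G (f ` S)"
    then show "x \<in> word_value G f ` words S"
    proof (induction rule: generate.induct)
      case one
      then show ?case by (auto intro!: image_eqI[of _ _ "[]"])
    next
      case (incl h)
      then obtain s where "s \<in> S" "h = f s" by auto
      moreover from this have "f s \<in> carrier G" using f by auto
      ultimately show ?case by (intro image_eqI[of _ _ "[(s, True)]"]) simp_all
    next
      case (inv h)
      then obtain s where "s \<in> S" "h = f s" by auto
      moreover from this have "f s \<in> carrier G" using f by auto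
      ultimately show ?case by (intro image_eqI[of _ _ "[(s, False)]"]) simp_all
    next
      case (eng h1 h2)
      then obtain v w where "v \<in> words S" "h1 = word_value G f v"
        "w \<in> words S" "h2 = word_value G f w" by auto
      then show ?case
        by (intro image_eqI[of _ _ "v @ w"]) (simp_all add: word_value_append[OF f])
    qed
  qed
qed

end

abbreviation word_class :: "'g set \<Rightarrow> ('g word \<times> 'g word) set \<Rightarrow> 'g word \<Rightarrow> 'g word set" where
  "word_class S R w \<equiv> word_rel S R `` {w}"

lemma word_class_eq_iff:
  assumes "v \<in> words S" "w \<in> words S"
  shows "word_class S R v = word_class S R w \<longleftrightarrow> word_cong S R v w"
  using eq_equiv_class_iff[OF equiv_word_rel assms] by (simp add: word_rel_def)

lemma presented_group_one: "\<one>\<^bsub>presented_group S R\<^esub> = word_class S R []"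
  by (simp add: presented_group_def)

lemma word_class_closed: "w \<in> words S \<Longrightarrow> word_class S R w \<in> carrier (presented_group S R)"
  by (auto simp: carrier_presented_group)

lemma carrier_presented_group_image: "carrier (presented_group S R) = word_class S R ` words S"
  by (auto simp only: carrier_presented_group)

text \<open>Evaluation under the tautological assignment. It makes every statement about
  \<open>word_value\<close> in a target group applicable to the elements of the presented group
  itself.\<close>

lemma word_value_presented_group:
  assumes "w \<in> words S"
  shows "word_value (presented_group S R) (\<lambda>s. word_class S R [(s, True)]) w = word_class S R w"
  using assms
proof (induction w)
  case Nil
  show ?case by (simp add: presented_group_one)
next
  case (Cons x w)
  obtain s b where x: "x = (s, b)" by (cases x)
  with Cons.prems have s: "s \<in> S" and w: "w \<in> words S" by auto
  interpret P: group "presented_group S R" by (rule group_presented_group)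
  \<comment> \<open>Cancelling in the order inverse, generator exhibits a left inverse, the form
    that \<open>inv_equality\<close> asks for.\<close>
  have "word_class S R [(s, False)] \<otimes>\<^bsub>presented_group S R\<^esub> word_class S R [(s, True)]
      = \<one>\<^bsub>presented_group S R\<^esub>"
    using s word_cong.cancel[of s S "[]" "[]" R False]
    by (simp add: presented_group_mult presented_group_one word_class_eq_iff)
  then have "inv\<^bsub>presented_group S R\<^esub> word_class S R [(s, True)] = word_class S R [(s, False)]"
    using s by (intro P.inv_equality) (simp_all add: word_class_closed)
  then have *: "(if snd x then word_class S R [(fst x, True)]
      else inv\<^bsub>presented_group S R\<^esub> word_class S R [(fst x, True)]) = word_class S R [x]"
    by (cases b) (simp_all only: x fst_conv snd_conv if_True if_False)
  have "[x] \<in> words S" using s x by simp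
  then show ?case
    by (simp only: word_value.simps * Cons.IH[OF w] presented_group_mult w append.simps)
qed

text \<open>The class is evaluated at an arbitrary representative; \<open>word_value_cong\<close>
  makes the choice harmless as soon as the relations hold in the target.\<close>

definition presented_hom ::
  "'g set \<Rightarrow> ('a, 'b) monoid_scheme \<Rightarrow> ('g \<Rightarrow> 'a) \<Rightarrow> 'g word set \<Rightarrow> 'a" where
  "presented_hom S G f C = word_value G f (SOME w. w \<in> C \<inter> words S)"

locale presentation_target = group G for G (structure) +
  fixes S :: "'g set" and R :: "('g word \<times> 'g word) set" and f :: "'g \<Rightarrow> 'a"
  assumes f_closed: "f \<in> S \<rightarrow> carrier G"
    and relations: "(l, r) \<in> R \<Longrightarrow> word_value G f l = word_value G f r"
begin

lemma presented_hom_class: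
  assumes "w \<in> words S"
  shows "presented_hom S G f (word_class S R w) = word_value G f w"
proof -
  have "w \<in> word_class S R w \<inter> words S"
    using assms by (simp add: word_rel_def word_cong.refl)
  then have "(SOME v. v \<in> word_class S R w \<inter> words S) \<in> word_class S R w \<inter> words S"
    by (rule someI)
  then have "word_cong S R w (SOME v. v \<in> word_class S R w \<inter> words S)"
    by (auto simp: word_rel_def)
  from word_value_cong[OF f_closed relations this] show ?thesis
    by (simp add: presented_hom_def)
qed

lemma presented_hom_hom: "presented_hom S G f \<in> hom (presented_group S R) G"
proof (rule homI)
  fix C assume "C \<in> carrier (presented_group S R)"
  then show "presented_hom S G f C \<in> carrier G"
    by (auto simp: carrier_presented_group presented_hom_class word_value_closed[OF f_closed])
next
  fix C D assume "C \<in> carrier (presented_group S R)" "D \<in> carrier (presented_group S R)"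
  then show "presented_hom S G f (C \<otimes>\<^bsub>presented_group S R\<^esub> D)
      = presented_hom S G f C \<otimes> presented_hom S G f D"
    by (auto simp: carrier_presented_group presented_group_mult presented_hom_class
        word_value_append[OF f_closed])
qed

lemma presented_hom_image: "presented_hom S G f ` carrier (presented_group S R) = generate G (f ` S)"
  unfolding generate_eq_word_values[OF f_closed]
  unfolding carrier_presented_group_image image_image
  by (rule image_cong) (simp_all only: presented_hom_class)

lemma presented_group_iso:
  assumes "\<And>C. C \<in> carrier (presented_group S R) \<Longrightarrow> presented_hom S G f C = \<one> \<Longrightarrow> C = \<one>\<^bsub>presented_group S R\<^esub>"
  shows "presented_group S R \<cong> G\<lparr>carrier := generate G (f ` S)\<rparr>"
proof -
  interpret H: group_hom "presented_group S R" G "presented_hom S G f"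
    by (intro group_hom.intro group_hom_axioms.intro group_presented_group is_group presented_hom_hom)
  have "inj_on (presented_hom S G f) (carrier (presented_group S R))"
    using assms by (simp add: H.inj_on_one_iff)
  then have "presented_hom S G f \<in> iso (presented_group S R) (G\<lparr>carrier := generate G (f ` S)\<rparr>)"
    using presented_hom_hom presented_hom_image
    by (simp add: iso_def bij_betw_def hom_def Pi_iff image_subset_iff[symmetric])
  then show ?thesis by (auto simp: is_iso_def)
qed

end

section \<open>Normal forms in quotients of the HNN extension\<close>

text \<open>Serves for two homomorphisms: conjugation by t, and the action of the presented group on
  the tree.\<close>

lemma power_prod_hom:
  assumes "group G" "group H" "h \<in> hom G H" "a ` set js \<subseteq> carrier G"
  shows "h (power_prod G a u js) = power_prod H (\<lambda>j. h (a j)) u js"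
proof -
  interpret group_hom G H h
    using assms by (simp add: group_hom_def group_hom_axioms_def)
  have "power_prod G a u js \<in> carrier G \<and> h (power_prod G a u js) = power_prod H (\<lambda>j. h (a j)) u js"
    using assms(4) by (induction js) (auto simp: hom_int_pow)
  then show ?thesis ..
qed

section \<open>Products of powers of commuting elements\<close>

context group
begin

lemma power_prod_closed:
  assumes "a ` set js \<subseteq> carrier G"
  shows "power_prod G a u js \<in> carrier G"
  using assms by (induction js) auto

lemma conjugation_hom:
  assumes "x \<in> carrier G"
  shows "(\<lambda>y. x \<otimes> y \<otimes> inv x) \<in> hom G G"
proof (rule homI)
  fix y z assume "y \<in> carrier G" "z \<in> carrier G"
  then show "x \<otimes> (y \<otimes> z) \<otimes> inv x = (x \<otimes> y \<otimes> inv x) \<otimes> (x \<otimes> z \<otimes> inv x)"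
    using assms by (simp add: m_assoc) (simp add: m_assoc[symmetric])
qed (use assms in simp)

text \<open>\<open>x\<close> and \<open>y\<close> are kept distinct for two uses: with x = y it
  extends commutation to negative exponents, and with different elements it moves a^v past a
  negative power of t, which transforms v by a power of M.\<close>

lemma inv_commute:
  assumes "p \<in> carrier G" "x \<in> carrier G" "y \<in> carrier G" "p \<otimes> x = y \<otimes> p"
  shows "x \<otimes> inv p = inv p \<otimes> y"
proof -
  have "x \<otimes> inv p = inv p \<otimes> (p \<otimes> x) \<otimes> inv p"
    using assms(1-3) by (simp add: m_assoc[symmetric])
  also have "\<dots> = inv p \<otimes> y"
    unfolding assms(4) using assms(1-3) by (simp add: m_assoc)
  finally show ?thesis .
qed

lemma int_pow_commute:
  assumes "x \<in> carrier G" "y \<in> carrier G" "x \<otimes> y = y \<otimes> x"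
  shows "x \<otimes> y [^] (k :: int) = y [^] k \<otimes> x"
proof (cases k)
  case (nonneg n)
  then show ?thesis
    using assms group_commutes_pow[of y x n] by (simp add: int_pow_int)
next
  case (neg n)
  have "y [^] Suc n \<otimes> x = x \<otimes> y [^] Suc n"
    using assms by (intro group_commutes_pow) simp_all
  then have "x \<otimes> inv (y [^] Suc n) = inv (y [^] Suc n) \<otimes> x"
    using assms by (intro inv_commute nat_pow_closed)
  then show ?thesis
    using assms neg int_pow_neg_int[of y "Suc n"] by simp
qed

lemma power_prod_commute:
  assumes "a ` set js \<subseteq> carrier G" "x \<in> carrier G" "\<And>j. j \<in> set js \<Longrightarrow> x \<otimes> a j = a j \<otimes> x"
  shows "x \<otimes> power_prod G a u js = power_prod G a u js \<otimes> x"
  using assms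
proof (induction js)
  case (Cons j js)
  have p: "a j \<in> carrier G" "power_prod G a u js \<in> carrier G"
    using Cons.prems by (auto intro: power_prod_closed)
  have "x \<otimes> a j [^] u j = a j [^] u j \<otimes> x"
    using Cons.prems by (intro int_pow_commute) auto
  moreover have "x \<otimes> power_prod G a u js = power_prod G a u js \<otimes> x"
    using Cons by auto
  ultimately show ?case
    using p Cons.prems(2) by (simp add: m_assoc[symmetric]) (simp add: m_assoc)
qed simp

lemma power_prod_zero:
  assumes "a ` set js \<subseteq> carrier G"
  shows "power_prod G a (\<lambda>_. 0) js = \<one>"
  using assms by (induction js) auto

lemma power_prod_add:
  assumes "a ` set js \<subseteq> carrier G"
    and "\<And>i j. i \<in> set js \<Longrightarrow> j \<in> set js \<Longrightarrow> a i \<otimes> a j = a j \<otimes> a i"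
  shows "power_prod G a (\<lambda>j. u j + v j) js = power_prod G a u js \<otimes> power_prod G a v js"
  using assms
proof (induction js)
  case (Cons j js)
  have p: "a j \<in> carrier G" "power_prod G a u js \<in> carrier G" "power_prod G a v js \<in> carrier G"
    using Cons.prems by (auto intro: power_prod_closed)
  have "a j [^] v j \<otimes> power_prod G a u js = power_prod G a u js \<otimes> a j [^] v j"
    using Cons.prems
    by (intro power_prod_commute) (auto intro!: int_pow_commute[symmetric])
  with p have "(a j [^] u j \<otimes> power_prod G a u js) \<otimes> (a j [^] v j \<otimes> power_prod G a v js)
      = a j [^] u j \<otimes> (a j [^] v j \<otimes> power_prod G a u js) \<otimes> power_prod G a v js"
    by (simp add: m_assoc)
  then show ?case
    using Cons p by (simp add: int_pow_mult m_assoc)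
qed simp

lemma power_prod_int_pow:
  assumes "a ` set js \<subseteq> carrier G"
    and "\<And>i j. i \<in> set js \<Longrightarrow> j \<in> set js \<Longrightarrow> a i \<otimes> a j = a j \<otimes> a i"
  shows "power_prod G a u js [^] (k :: int) = power_prod G a (\<lambda>j. u j * k) js"
  using assms
proof (induction js)
  case (Cons j js)
  have p: "a j \<in> carrier G" "power_prod G a u js \<in> carrier G"
    using Cons.prems by (auto intro: power_prod_closed)
  have "a j [^] u j \<otimes> power_prod G a u js = power_prod G a u js \<otimes> a j [^] u j"
    using Cons.prems
    by (intro power_prod_commute) (auto intro!: int_pow_commute[symmetric])
  from int_pow_mult_distrib[OF this] show ?case
    using Cons p by (simp add: int_pow_pow)
qed simp

text \<open>Matrix-vector multiplication in the exponents: if \<open>c i\<close> is the i-th column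
  of a matrix, the exponents on the right are the entries of its product with
  \<open>u\<close>.\<close>

lemma power_prod_power_prod:
  assumes "a ` set js \<subseteq> carrier G"
    and "\<And>i j. i \<in> set js \<Longrightarrow> j \<in> set js \<Longrightarrow> a i \<otimes> a j = a j \<otimes> a i"
  shows "power_prod G (\<lambda>i. power_prod G a (c i) js) u is
    = power_prod G a (\<lambda>j. \<Sum>i\<leftarrow>is. c i j * u i) js"
proof (induction "is")
  case Nil
  then show ?case using assms(1) by (simp add: power_prod_zero)
next
  case (Cons i "is")
  then show ?case using assms by (simp add: power_prod_int_pow power_prod_add)
qed

lemma power_prod_unit:
  assumes "a ` set js \<subseteq> carrier G" "distinct js" "i \<in> set js"
  shows "power_prod G a (\<lambda>j. if j = i then k else 0) js = a i [^] k"
  using assms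
proof (induction js)
  case (Cons j js)
  show ?case
  proof (cases "j = i")
    case True
    then have "power_prod G a (\<lambda>j. if j = i then k else 0) js = power_prod G a (\<lambda>_. 0) js"
      using Cons.prems by (intro power_prod_cong) auto
    then show ?thesis
      using True Cons.prems by (simp add: power_prod_zero)
  next
    case False
    then have "a i \<in> carrier G" using Cons.prems by auto
    moreover have "power_prod G a (\<lambda>j. if j = i then k else 0) js = a i [^] k"
      using False Cons.prems by (intro Cons.IH) auto
    ultimately show ?thesis using False by simp
  qed
qed simp

end

text \<open>Instantiated twice below, with the tree group and with G_M itself.\<close>

locale hnn_target = presentation_target G "hnn_gens d" "hnn_relations d M" f
  for G (structure) and d M f +
  assumes M: "M \<in> carrier_mat d d"
begin

abbreviation t where "t \<equiv> f Stable"

text \<open>The monomial a^v, that is, the homomorphism from Z^d determined by the base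
  generators.\<close>

definition base_elt :: "int vec \<Rightarrow> 'a" where
  "base_elt v = power_prod G (\<lambda>j. f (Base j)) (\<lambda>j. v $ j) [0..<d]"

lemma t_closed: "t \<in> carrier G"
  using f_closed by (auto simp: hnn_gens_def)

lemma Base_closed: "i < d \<Longrightarrow> f (Base i) \<in> carrier G"
  using f_closed by (auto simp: hnn_gens_def)

lemma Base_closed': "(\<lambda>j. f (Base j)) ` set [0..<d] \<subseteq> carrier G"
  using Base_closed by auto

lemma Base_commute:
  assumes "i \<in> set [0..<d]" "j \<in> set [0..<d]"
  shows "f (Base i) \<otimes> f (Base j) = f (Base j) \<otimes> f (Base i)"
proof -
  have "([(Base i, True), (Base j, True)], [(Base j, True), (Base i, True)]) \<in> hnn_relations d M"
    using assms by (auto simp: hnn_relations_def)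
  from relations[OF this] show ?thesis
    using assms Base_closed by simp
qed

lemma base_elt_closed: "base_elt v \<in> carrier G"
  unfolding base_elt_def by (rule power_prod_closed[OF Base_closed'])

lemma base_elt_add:
  assumes "v \<in> carrier_vec d" "w \<in> carrier_vec d"
  shows "base_elt (v + w) = base_elt v \<otimes> base_elt w"
proof -
  have "base_elt (v + w) = power_prod G (\<lambda>j. f (Base j)) (\<lambda>j. v $ j + w $ j) [0..<d]"
    unfolding base_elt_def using assms by (intro power_prod_cong) auto
  then show ?thesis
    unfolding base_elt_def by (simp only: power_prod_add[OF Base_closed' Base_commute])
qed

lemma base_elt_zero: "base_elt (0\<^sub>v d) = \<one>"
proof -
  have "base_elt (0\<^sub>v d) = power_prod G (\<lambda>j. f (Base j)) (\<lambda>_. 0) [0..<d]"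
    unfolding base_elt_def by (intro power_prod_cong) auto
  then show ?thesis using power_prod_zero[OF Base_closed'] by simp
qed

lemma base_elt_unit:
  assumes "i < d"
  shows "base_elt (k \<cdot>\<^sub>v unit_vec d i) = f (Base i) [^] k"
proof -
  have "base_elt (k \<cdot>\<^sub>v unit_vec d i)
      = power_prod G (\<lambda>j. f (Base j)) (\<lambda>j. if j = i then k else 0) [0..<d]"
    unfolding base_elt_def using assms by (intro power_prod_cong) auto
  then show ?thesis
    using power_prod_unit[OF Base_closed', of i k] assms by simp
qed

text \<open>Conjugation by t is a homomorphism, hence known from its values on the base generators,
  where the relations substitute the columns of M. The form without inverses is the one that
  iterates.\<close>

lemma t_base_elt:
  assumes v: "v \<in> carrier_vec d"
  shows "t \<otimes> base_elt v = base_elt (M *\<^sub>v v) \<otimes> t"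
proof -
  have conj: "t \<otimes> f (Base i) \<otimes> inv t = power_prod G (\<lambda>j. f (Base j)) (\<lambda>j. M $$ (j, i)) [0..<d]"
    if i: "i < d" for i
  proof -
    have "([(Stable, True), (Base i, True), (Stable, False)],
        concat (map (\<lambda>j. gen_power (Base j) (M $$ (j, i))) [0..<d])) \<in> hnn_relations d M"
      using i by (auto simp: hnn_relations_def)
    from relations[OF this] show ?thesis
      using i Base_closed t_closed word_value_concat_gen_power[OF f_closed, of "[0..<d]" Base]
      by (simp add: hnn_gens_def m_assoc)
  qed
  have "t \<otimes> base_elt v \<otimes> inv t
      = power_prod G (\<lambda>i. t \<otimes> f (Base i) \<otimes> inv t) (\<lambda>i. v $ i) [0..<d]"
    unfolding base_elt_def
    by (rule power_prod_hom[OF is_group is_group conjugation_hom[OF t_closed] Base_closed'])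
  also have "\<dots> = power_prod G (\<lambda>i. power_prod G (\<lambda>j. f (Base j)) (\<lambda>j. M $$ (j, i)) [0..<d])
      (\<lambda>i. v $ i) [0..<d]"
    by (intro power_prod_cong) (simp_all add: conj)
  also have "\<dots> = power_prod G (\<lambda>j. f (Base j)) (\<lambda>j. \<Sum>i\<leftarrow>[0..<d]. M $$ (j, i) * v $ i) [0..<d]"
    by (rule power_prod_power_prod[OF Base_closed' Base_commute])
  also have "\<dots> = base_elt (M *\<^sub>v v)"
    unfolding base_elt_def
    using M v by (intro power_prod_cong)
      (auto simp: scalar_prod_def interv_sum_list_conv_sum_set_nat)
  finally have "base_elt (M *\<^sub>v v) \<otimes> t = t \<otimes> base_elt v \<otimes> inv t \<otimes> t" by simp
  then show ?thesis
    using t_closed base_elt_closed by (simp add: m_assoc)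
qed

lemma t_pow_base_elt:
  assumes "v \<in> carrier_vec d"
  shows "t [^] (p :: nat) \<otimes> base_elt v = base_elt ((M ^\<^sub>m p) *\<^sub>v v) \<otimes> t [^] p"
  using assms
proof (induction p arbitrary: v)
  case 0
  then show ?case using M by (simp add: base_elt_closed)
next
  case (Suc p)
  have Mv: "M *\<^sub>v v \<in> carrier_vec d" using M Suc.prems by simp
  have "t [^] Suc p \<otimes> base_elt v = t [^] p \<otimes> base_elt (M *\<^sub>v v) \<otimes> t"
    using t_closed base_elt_closed by (simp add: m_assoc t_base_elt[OF Suc.prems])
  then show ?case
    unfolding Suc.IH[OF Mv]
    using M Suc.prems t_closed base_elt_closed
    by (simp add: m_assoc assoc_mult_mat_vec[OF pow_carrier_mat[OF M] M Suc.prems])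
qed

text \<open>This is the direction in which the extension ascends: passing a^v to the right of t^-p
  keeps the exponents integral, whereas passing it to the left would require the inverse of
  M.\<close>

lemma base_elt_inv_t_pow:
  assumes "v \<in> carrier_vec d"
  shows "base_elt v \<otimes> inv (t [^] (p :: nat)) = inv (t [^] p) \<otimes> base_elt ((M ^\<^sub>m p) *\<^sub>v v)"
  by (intro inv_commute t_pow_base_elt[OF assms] base_elt_closed nat_pow_closed t_closed)

text \<open>Letters are multiplied on from the left. An inverse of t increases p; a base letter is
  pushed through t^-p and absorbed into a^v; t cancels against t^-p if p > 0, and otherwise crosses
  a^v and joins t^q.\<close>

lemma word_value_normal_form:
  assumes "w \<in> words (hnn_gens d)"
  shows "\<exists>(p :: nat) (q :: nat). \<exists>v\<in>carrier_vec d.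
    word_value G f w = inv (t [^] p) \<otimes> (base_elt v \<otimes> t [^] q)"
  using assms
proof (induction w)
  case Nil
  have "word_value G f [] = inv (t [^] (0 :: nat)) \<otimes> (base_elt (0\<^sub>v d) \<otimes> t [^] (0 :: nat))"
    by (simp add: base_elt_zero)
  then show ?case using zero_carrier_vec by blast
next
  case (Cons x w)
  obtain s b where x: "x = (s, b)" by (cases x)
  with Cons have "s \<in> hnn_gens d" "w \<in> words (hnn_gens d)" by auto
  with Cons.IH obtain p q :: nat and v where v: "v \<in> carrier_vec d"
    and w: "word_value G f w = inv (t [^] p) \<otimes> (base_elt v \<otimes> t [^] q)" by blast
  note [simp] = t_closed base_elt_closed
  consider (base) i where "s = Base i" "i < d" | (up) "s = Stable" "b" | (down) "s = Stable" "\<not> b"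
    using \<open>s \<in> hnn_gens d\<close> by (auto simp: hnn_gens_def)
  then show ?case
  proof cases
    case base
    define u :: "int vec" where "u = (if b then 1 else - 1) \<cdot>\<^sub>v unit_vec d i"
    have u: "u \<in> carrier_vec d" by (simp add: u_def)
    have "(if b then f (Base i) else inv f (Base i)) = base_elt u"
      using base by (simp add: u_def base_elt_unit Base_closed int_pow_neg)
    then have "word_value G f (x # w) = base_elt u \<otimes> (inv (t [^] p) \<otimes> (base_elt v \<otimes> t [^] q))"
      by (simp only: word_value.simps x base w fst_conv snd_conv)
    also have "\<dots> = base_elt u \<otimes> inv (t [^] p) \<otimes> (base_elt v \<otimes> t [^] q)"
      by (simp add: m_assoc)
    also have "\<dots> = inv (t [^] p) \<otimes> (base_elt ((M ^\<^sub>m p) *\<^sub>v u + v) \<otimes> t [^] q)"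
      unfolding base_elt_inv_t_pow[OF u]
        base_elt_add[OF mult_mat_vec_carrier[OF pow_carrier_mat[OF M] u] v]
      by (simp add: m_assoc)
    finally show ?thesis
      using add_carrier_vec[OF mult_mat_vec_carrier[OF pow_carrier_mat[OF M] u] v] by blast
  next
    case down
    then have "word_value G f (x # w) = inv (t [^] Suc p) \<otimes> (base_elt v \<otimes> t [^] q)"
      by (simp add: x w inv_mult_group m_assoc)
    then show ?thesis using v by blast
  next
    case up
    show ?thesis
    proof (cases p)
      case 0
      then have "word_value G f (x # w) = t \<otimes> base_elt v \<otimes> t [^] q"
        using up by (simp add: x w m_assoc)
      also have "\<dots> = inv (t [^] p) \<otimes> (base_elt (M *\<^sub>v v) \<otimes> t [^] Suc q)"
        unfolding t_base_elt[OF v] using 0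
        by (simp add: m_assoc nat_pow_Suc2[symmetric] del: nat_pow_Suc)
      finally show ?thesis
        using mult_mat_vec_carrier[OF M v] by blast
    next
      case (Suc p')
      then have "word_value G f (x # w) = inv (t [^] p') \<otimes> (base_elt v \<otimes> t [^] q)"
        using up by (simp add: x w inv_mult_group m_assoc[symmetric])
      then show ?thesis using v by blast
    qed
  qed
qed

end

section \<open>Affine maps on words of digit vectors\<close>

lemma index_mult_mat_vec_sum:
  assumes "B \<in> carrier_mat d d" "x \<in> carrier_vec d" "i < d"
  shows "(B *\<^sub>v x) $ i = (\<Sum>j<d. B $$ (i, j) * x $ j)"
  using assms by (auto simp: scalar_prod_def lessThan_atLeast0 intro!: sum.cong)

lemma adj_mat_mult_vec:
  fixes B :: "'a :: comm_ring_1 mat"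
  assumes "B \<in> carrier_mat d d" "x \<in> carrier_vec d"
  shows "adj_mat B *\<^sub>v (B *\<^sub>v x) = det B \<cdot>\<^sub>v x"
proof -
  have "adj_mat B *\<^sub>v (B *\<^sub>v x) = (det B \<cdot>\<^sub>m 1\<^sub>m d) *\<^sub>v x"
    by (simp only: assoc_mult_mat_vec[OF adj_mat(1)[OF assms(1)] assms, symmetric]
        adj_mat(3)[OF assms(1)])
  also have "\<dots> = det B \<cdot>\<^sub>v x"
    using assms by (intro eq_vecI) auto
  finally show ?thesis .
qed

lemma cong_mult_mat_vec:
  assumes "B \<in> carrier_mat d d" "x \<in> carrier_vec d" "y \<in> carrier_vec d"
    and "\<And>i. i < d \<Longrightarrow> [x $ i = y $ i] (mod m)" "i < d"
  shows "[(B *\<^sub>v x) $ i = (B *\<^sub>v y) $ i] (mod (m :: int))"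
  unfolding index_mult_mat_vec_sum[OF assms(1,2,5)] index_mult_mat_vec_sum[OF assms(1,3,5)]
  using assms(4) by (intro cong_sum cong_mult cong_refl) auto

text \<open>Multiplying by the adjugate replaces B by the scalar \<open>det B\<close>, which is a
  unit modulo \<open>m\<close>.\<close>

lemma cong_mult_mat_vec_cancel:
  assumes B: "B \<in> carrier_mat d d" "coprime (det B) m"
    and xy: "x \<in> carrier_vec d" "y \<in> carrier_vec d"
    and eq: "\<And>i. i < d \<Longrightarrow> [(B *\<^sub>v x) $ i = (B *\<^sub>v y) $ i] (mod m)" and i: "i < d"
  shows "[x $ i = y $ i] (mod (m :: int))"
proof -
  have "[(adj_mat B *\<^sub>v (B *\<^sub>v x)) $ i = (adj_mat B *\<^sub>v (B *\<^sub>v y)) $ i] (mod m)"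
    using B xy by (intro cong_mult_mat_vec[OF adj_mat(1)[OF B(1)] _ _ eq i]) simp_all
  then have "[det B * x $ i = det B * y $ i] (mod m)"
    using i xy by (simp add: adj_mat_mult_vec[OF B(1)])
  then show ?thesis
    using B(2) by (simp add: cong_mult_lcancel)
qed

text \<open>Half-open, so that it covers the digit vectors (bounds \<open>0\<close> and
  \<open>n\<close>) as well as the translation vectors of the states (bounds \<open>- r\<close> and
  \<open>r\<close>), and fits rounding down in the carry.\<close>

definition int_cube :: "nat \<Rightarrow> int \<Rightarrow> int \<Rightarrow> int vec set" where
  "int_cube d a b = {x \<in> carrier_vec d. \<forall>i<d. a \<le> x $ i \<and> x $ i < b}"

lemma bij_betw_int_cube:
  "bij_betw (vec d) (PiE {..<d} (\<lambda>_. {a..<b})) (int_cube d a b)"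
proof (rule bij_betw_byWitness[of _ "\<lambda>x. restrict (\<lambda>i. x $ i) {..<d}"])
  show "\<forall>x\<in>PiE {..<d} (\<lambda>_. {a..<b}). restrict (\<lambda>i. vec d x $ i) {..<d} = x"
    by (intro ballI ext) (simp add: PiE_def extensional_def)
  show "\<forall>x\<in>int_cube d a b. vec d (restrict (\<lambda>i. x $ i) {..<d}) = x"
    by (auto simp: int_cube_def)
  show "vec d ` PiE {..<d} (\<lambda>_. {a..<b}) \<subseteq> int_cube d a b"
    by (rule image_subsetI) (simp add: int_cube_def PiE_def Pi_def)
  show "(\<lambda>x. restrict (\<lambda>i. x $ i) {..<d}) ` int_cube d a b \<subseteq> PiE {..<d} (\<lambda>_. {a..<b})"
    by (rule image_subsetI) (simp add: int_cube_def PiE_def Pi_def)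
qed

lemma finite_int_cube: "finite (int_cube d a b)"
  using bij_betw_finite[OF bij_betw_int_cube, of d a b] by (simp add: finite_PiE)

lemma card_int_cube: "card (int_cube d a b) = nat (b - a) ^ d"
  using bij_betw_same_card[OF bij_betw_int_cube, of d a b] by (simp add: card_PiE)

lemma to_nat_on_finite_less: "finite S \<Longrightarrow> s \<in> S \<Longrightarrow> to_nat_on S s < card S"
  using bij_betwE[OF to_nat_on_finite, of S] by auto

lemma from_nat_into_finite_mem: "finite S \<Longrightarrow> c < card S \<Longrightarrow> from_nat_into S c \<in> S"
  using bij_betwE[OF bij_betw_from_nat_into_finite, of S] by auto

lemma from_nat_into_to_nat_on_finite: "finite S \<Longrightarrow> s \<in> S \<Longrightarrow> from_nat_into S (to_nat_on S s) = s"
  by (simp add: countable_finite)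

section \<open>Base-n expansions and affine tree automorphisms\<close>

locale digit_tree =
  fixes d n :: nat
  assumes n: "n \<ge> 2"
begin

abbreviation letters :: "nat set" where
  "letters \<equiv> {..<n ^ d}"

text \<open>Letters, and later states, are natural numbers because the automaton is to have type
  \<open>(nat, nat) automaton\<close>; the enumeration of the cube is arbitrary.\<close>

definition digit :: "nat \<Rightarrow> int vec" where
  "digit = from_nat_into (int_cube d 0 (int n))"

definition letter_of :: "int vec \<Rightarrow> nat" where
  "letter_of = to_nat_on (int_cube d 0 (int n))"

lemma digit_in_cube: "c \<in> letters \<Longrightarrow> digit c \<in> int_cube d 0 (int n)"
  using from_nat_into_finite_mem[OF finite_int_cube, of c d 0 "int n"]
  by (simp add: digit_def card_int_cube)

lemma digit_letter_of: "x \<in> int_cube d 0 (int n) \<Longrightarrow> digit (letter_of x) = x"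
  by (simp add: digit_def letter_of_def from_nat_into_to_nat_on_finite finite_int_cube)

lemma letter_of_in_letters: "x \<in> int_cube d 0 (int n) \<Longrightarrow> letter_of x \<in> letters"
  using to_nat_on_finite_less[OF finite_int_cube, of x d 0 "int n"]
  by (simp add: letter_of_def card_int_cube)

lemma digit_inj:
  assumes "b \<in> letters" "c \<in> letters" "\<And>i. i < d \<Longrightarrow> [digit b $ i = digit c $ i] (mod int n)"
  shows "b = c"
proof -
  have "digit b = digit c"
  proof (rule eq_vecI)
    fix i assume "i < dim_vec (digit c)"
    then show "digit b $ i = digit c $ i"
      using assms(3)[of i] digit_in_cube[OF assms(1)] digit_in_cube[OF assms(2)]
      by (auto simp: int_cube_def cong_def)
  qed (use digit_in_cube[OF assms(1)] digit_in_cube[OF assms(2)] in \<open>auto simp: int_cube_def\<close>)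
  then show ?thesis
    using bij_betw_from_nat_into_finite[OF finite_int_cube, of d 0 "int n"] assms(1,2)
    by (auto simp: digit_def bij_betw_def card_int_cube dest: inj_onD)
qed

text \<open>The least significant digit comes first: a prefix of length k then fixes the value
  modulo n^k, and carries travel in the reading direction.\<close>

primrec val :: "nat list \<Rightarrow> int vec" where
  "val [] = 0\<^sub>v d"
| "val (c # w) = digit c + int n \<cdot>\<^sub>v val w"

lemma val_carrier: "w \<in> lists letters \<Longrightarrow> val w \<in> carrier_vec d"
  using digit_in_cube by (induction w) (auto simp: int_cube_def)

lemma val_Cons_index:
  assumes "c \<in> letters" "w \<in> lists letters" "i < d"
  shows "val (c # w) $ i = digit c $ i + int n * val w $ i"
  using assms val_carrier[OF assms(2)] digit_in_cube[OF assms(1)] by (simp add: int_cube_def)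

text \<open>Modulo n the value shows the first letter. Once it is removed, a factor n cancels from
  both sides and from the modulus.\<close>

lemma val_inj:
  assumes "u \<in> lists letters" "w \<in> lists letters" "length u = length w"
    and "\<And>i. i < d \<Longrightarrow> [val u $ i = val w $ i] (mod int n ^ length w)"
  shows "u = w"
  using assms
proof (induction u arbitrary: w rule: list.induct)
  case (Cons b u)
  then obtain c v where w: "w = c # v" by (cases w) auto
  have bc: "b \<in> letters" "c \<in> letters" "u \<in> lists letters" "v \<in> lists letters"
    using Cons.prems w by auto
  have eq: "[digit b $ i + int n * val u $ i = digit c $ i + int n * val v $ i] (mod int n * int n ^ length v)"
    if "i < d" for i
    using Cons.prems(4)[OF that] bc that by (simp only: w val_Cons_index length_Cons power_Suc)
  have "b = c"
  proof (rule digit_inj[OF bc(1,2)])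
    fix i assume "i < d"
    from cong_dvd_modulus[OF eq[OF this], of "int n"]
    show "[digit b $ i = digit c $ i] (mod int n)"
      by (simp add: cong_def)
  qed
  moreover have "u = v"
  proof (rule Cons.IH[OF bc(3,4)])
    show "length u = length v" using Cons.prems w by simp
    fix i assume "i < d"
    from eq[OF this] have "[int n * val u $ i = int n * val v $ i] (mod int n * int n ^ length v)"
      by (simp add: \<open>b = c\<close> cong_add_lcancel)
    then show "[val u $ i = val v $ i] (mod int n ^ length v)"
      using n by (simp add: cong_iff_dvd_diff right_diff_distrib[symmetric])
  qed
  ultimately show ?case using w by simp
qed simp

text \<open>Says that \<open>f\<close> acts on Z_n^d as x -> B x + v, level by level: words of
  length k stand for residues modulo n^k.\<close>

definition realizes :: "(nat list \<Rightarrow> nat list) \<Rightarrow> int mat \<Rightarrow> int vec \<Rightarrow> bool" where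
  "realizes f B v \<longleftrightarrow> f \<in> carrier (tree_Aut letters) \<and>
    (\<forall>w\<in>lists letters. length (f w) = length w \<and>
      (\<forall>i<d. [val (f w) $ i = (B *\<^sub>v val w + v) $ i] (mod int n ^ length w)))"

lemma realizesD:
  assumes "realizes f B v"
  shows "f \<in> carrier (tree_Aut letters)" "f \<in> Bij (lists letters)"
    and "w \<in> lists letters \<Longrightarrow> f w \<in> lists letters"
    and "w \<in> lists letters \<Longrightarrow> length (f w) = length w"
    and "w \<in> lists letters \<Longrightarrow> i < d \<Longrightarrow> [val (f w) $ i = (B *\<^sub>v val w + v) $ i] (mod int n ^ length w)"
proof -
  show "f \<in> carrier (tree_Aut letters)" using assms by (simp add: realizes_def)
  then have "f \<in> tree_automorphisms letters" by (simp add: tree_Aut_def)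
  from tree_automorphismsD[OF this] show "f \<in> Bij (lists letters)"
    "w \<in> lists letters \<Longrightarrow> f w \<in> lists letters" by simp_all
qed (use assms in \<open>simp_all add: realizes_def\<close>)

text \<open>On each level the congruences fix the value of the image word, hence the word.
  Identities between tree automorphisms thus reduce to identities between pairs (B, v).\<close>

lemma realizes_unique:
  assumes f: "realizes f B v" and g: "realizes g B v"
  shows "f = g"
proof (rule extensionalityI)
  show "f \<in> extensional (lists letters)" "g \<in> extensional (lists letters)"
    using realizesD(2)[OF f] realizesD(2)[OF g] by (simp_all add: Bij_def)
  fix w assume w: "w \<in> lists letters"
  show "f w = g w"
  proof (rule val_inj)
    fix i assume "i < d"
    from cong_trans[OF realizesD(5)[OF f w this] cong_sym[OF realizesD(5)[OF g w this]]]
    show "[val (f w) $ i = val (g w) $ i] (mod int n ^ length (g w))"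
      using realizesD(4)[OF g w] by simp
  qed (use realizesD[OF f] realizesD[OF g] w in simp_all)
qed

lemma tree_Aut_mult:
  assumes "f \<in> Bij (lists letters)" "g \<in> Bij (lists letters)"
  shows "f \<otimes>\<^bsub>tree_Aut letters\<^esub> g = compose (lists letters) f g"
  using assms by (simp add: tree_Aut_def BijGroup_def)

lemma realizes_mult:
  assumes B: "B \<in> carrier_mat d d" "C \<in> carrier_mat d d" "v \<in> carrier_vec d" "w \<in> carrier_vec d"
    and f: "realizes f B v" and g: "realizes g C w"
  shows "realizes (f \<otimes>\<^bsub>tree_Aut letters\<^esub> g) (B * C) (B *\<^sub>v w + v)"
proof -
  interpret group "tree_Aut letters" by (rule group_tree_Aut)
  have "[val (f (g u)) $ i = (B * C *\<^sub>v val u + (B *\<^sub>v w + v)) $ i] (mod int n ^ length u)"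
    if u: "u \<in> lists letters" and i: "i < d" for u i
  proof -
    note gu = realizesD(3)[OF g u] realizesD(4)[OF g u]
    have "[val (f (g u)) $ i = (B *\<^sub>v val (g u)) $ i + v $ i] (mod int n ^ length u)"
      using realizesD(5)[OF f gu(1) i] B(1,3) i by (simp add: gu(2))
    also have "[(B *\<^sub>v val (g u)) $ i + v $ i = (B *\<^sub>v (C *\<^sub>v val u + w)) $ i + v $ i] (mod int n ^ length u)"
      using B val_carrier[OF u] val_carrier[OF gu(1)] realizesD(5)[OF g u] i
      by (intro cong_add cong_refl cong_mult_mat_vec[OF B(1)]) simp_all
    also have "(B *\<^sub>v (C *\<^sub>v val u + w)) $ i + v $ i = (B * C *\<^sub>v val u + (B *\<^sub>v w + v)) $ i"
    proof -
      have "B *\<^sub>v (C *\<^sub>v val u + w) = B *\<^sub>v (C *\<^sub>v val u) + B *\<^sub>v w"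
        using B val_carrier[OF u] by (intro mult_add_distrib_mat_vec) auto
      then show ?thesis
        using B val_carrier[OF u] i by (simp add: assoc_mult_mat_vec[OF B(1,2)])
    qed
    finally show ?thesis .
  qed
  moreover have "f \<otimes>\<^bsub>tree_Aut letters\<^esub> g \<in> carrier (tree_Aut letters)"
    using realizesD(1)[OF f] realizesD(1)[OF g] by simp
  ultimately show ?thesis
    using realizesD[OF f] realizesD[OF g]
    by (simp add: realizes_def tree_Aut_mult compose_eq)
qed

text \<open>Words of value 0 reveal v, and words of value e_j reveal v plus column j of the matrix.
  Padding with zero digits raises the modulus to any power of n while the value stays fixed.\<close>

lemma realizes_determines:
  assumes B: "B \<in> carrier_mat d d" "C \<in> carrier_mat d d" "v \<in> carrier_vec d" "w \<in> carrier_vec d"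
    and f: "realizes f B v" "realizes f C w"
  shows "B = C \<and> v = w"
proof -
  \<comment> \<open>Since \<open>n \<ge> 2\<close>, the number 1 is a digit and each unit vector is
    the value of a single letter.\<close>
  have cube: "x \<in> int_cube d 0 (int n)" if "x = 0\<^sub>v d \<or> (\<exists>j<d. x = unit_vec d j)" for x
    using that n by (auto simp: int_cube_def)
  define zs where "zs k = replicate k (letter_of (0\<^sub>v d))" for k
  have zs: "zs k \<in> lists letters" for k
    using letter_of_in_letters[OF cube] by (auto simp: zs_def)
  have val_zs: "val (zs k) = 0\<^sub>v d" for k
    by (induction k) (auto simp: zs_def digit_letter_of[OF cube])
  \<comment> \<open>A nonzero difference of absolute value m would be divisible by n^m, which
    exceeds m.\<close>
  have eq_if_cong: "a = b" if "\<And>k. [a = b] (mod int n ^ k)" for a b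
  proof (rule ccontr)
    assume "a \<noteq> b"
    have "int n ^ nat \<bar>a - b\<bar> dvd \<bar>a - b\<bar>" using that by (simp add: cong_iff_dvd_diff)
    then have "int n ^ nat \<bar>a - b\<bar> \<le> \<bar>a - b\<bar>" using \<open>a \<noteq> b\<close> by (intro zdvd_imp_le) auto
    moreover have "\<bar>a - b\<bar> < int n ^ nat \<bar>a - b\<bar>"
    proof -
      have "nat \<bar>a - b\<bar> < 2 ^ nat \<bar>a - b\<bar>" by simp
      also have "\<dots> \<le> n ^ nat \<bar>a - b\<bar>" using n by (simp add: power_mono)
      finally show ?thesis by (simp add: nat_less_iff)
    qed
    ultimately show False by simp
  qed
  have vw: "v = w"
  proof (rule eq_vecI)
    fix i assume "i < dim_vec w"
    then have i: "i < d" using B by simp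
    show "v $ i = w $ i"
    proof (rule eq_if_cong)
      fix k
      from cong_trans[OF cong_sym[OF realizesD(5)[OF f(1) zs i]] realizesD(5)[OF f(2) zs i], of k]
      show "[v $ i = w $ i] (mod int n ^ k)"
        using B i by (simp add: val_zs) (simp add: zs_def)
    qed
  qed (use B in simp)
  moreover have "B = C"
  proof (rule eq_matI)
    fix i j assume "i < dim_row C" "j < dim_col C"
    then have i: "i < d" and j: "j < d" using B by auto
    show "B $$ (i, j) = C $$ (i, j)"
    proof (rule eq_if_cong)
      fix k
      define u where "u = letter_of (unit_vec d j) # zs k"
      have "letter_of (unit_vec d j) \<in> letters"
        using j by (intro letter_of_in_letters cube) auto
      then have u: "u \<in> lists letters" using zs by (auto simp: u_def)
      have "val u = unit_vec d j"
        using j by (auto simp: u_def val_zs digit_letter_of[OF cube])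
      with cong_trans[OF cong_sym[OF realizesD(5)[OF f(1) u i]] realizesD(5)[OF f(2) u i]]
      have "[B $$ (i, j) + v $ i = C $$ (i, j) + v $ i] (mod int n ^ length u)"
        using B i j by (simp add: vw)
      then have "[B $$ (i, j) = C $$ (i, j)] (mod int n ^ length u)"
        by (simp add: cong_add_rcancel)
      then show "[B $$ (i, j) = C $$ (i, j)] (mod int n ^ k)"
        by (rule cong_dvd_modulus) (simp add: u_def zs_def)
    qed
  qed (use B in auto)
  ultimately show ?thesis by simp
qed


section \<open>The automaton of the affine maps with a fixed linear part\<close>

definition affine_aut :: "int mat \<Rightarrow> int \<Rightarrow> (nat, nat) automaton" where
  "affine_aut B r =
    \<lparr>states = {..<card (int_cube d (- r) r)},
     alphabet = letters,
     rewriting = (\<lambda>q c. letter_of (map_vec (\<lambda>z. z mod int n)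
       (B *\<^sub>v digit c + from_nat_into (int_cube d (- r) r) q))),
     transition = (\<lambda>q c. to_nat_on (int_cube d (- r) r) (map_vec (\<lambda>z. z div int n)
       (B *\<^sub>v digit c + from_nat_into (int_cube d (- r) r) q)))\<rparr>"

end

locale affine_automaton = digit_tree +
  fixes B :: "int mat" and r :: int
  assumes B: "B \<in> carrier_mat d d" and det_coprime: "coprime (det B) (int n)"
    and row_sums: "i < d \<Longrightarrow> (\<Sum>j<d. \<bar>B $$ (i, j)\<bar>) \<le> r"
begin

abbreviation "A \<equiv> affine_aut B r"

definition shift :: "nat \<Rightarrow> int vec" where
  "shift = from_nat_into (int_cube d (- r) r)"

lemma shift_in_cube: "q \<in> states A \<Longrightarrow> shift q \<in> int_cube d (- r) r"
  using from_nat_into_finite_mem[OF finite_int_cube, of q d "- r" r]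
  by (simp add: shift_def affine_aut_def)

lemma shift_carrier: "q \<in> states A \<Longrightarrow> shift q \<in> carrier_vec d"
  using shift_in_cube by (simp add: int_cube_def)

lemma alphabet_A: "alphabet A = letters"
  by (simp add: affine_aut_def)

lemma remainder_in_cube:
  assumes "z \<in> carrier_vec d"
  shows "map_vec (\<lambda>z. z mod int n) z \<in> int_cube d 0 (int n)"
  using assms n by (simp add: int_cube_def)

text \<open>The entries of \<open>x\<close> are at most n - 1, so those of B x are bounded by r (n -
  1) in absolute value. Adding an entry of \<open>v\<close> lands in the half-open interval from - n
  r to n r, and division by n with rounding down maps this into the one from - r to r.\<close>

lemma carry_in_cube:
  assumes x: "x \<in> int_cube d 0 (int n)" and v: "v \<in> int_cube d (- r) r"
  shows "map_vec (\<lambda>z. z div int n) (B *\<^sub>v x + v) \<in> int_cube d (- r) r"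
proof -
  have xv: "x \<in> carrier_vec d" "v \<in> carrier_vec d" using x v by (simp_all add: int_cube_def)
  have "- r \<le> (B *\<^sub>v x + v) $ i div int n \<and> (B *\<^sub>v x + v) $ i div int n < r" if i: "i < d" for i
  proof -
    define z where "z = (B *\<^sub>v x + v) $ i"
    have z: "z = (B *\<^sub>v x) $ i + v $ i" using B xv i by (simp add: z_def)
    have "\<bar>(B *\<^sub>v x) $ i\<bar> \<le> (\<Sum>j<d. \<bar>B $$ (i, j) * x $ j\<bar>)"
      unfolding index_mult_mat_vec_sum[OF B xv(1) i] by (rule sum_abs)
    also have "\<dots> \<le> (\<Sum>j<d. \<bar>B $$ (i, j)\<bar> * (int n - 1))"
      using x by (intro sum_mono) (auto simp: int_cube_def abs_mult intro!: mult_left_mono)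
    also have "\<dots> = (\<Sum>j<d. \<bar>B $$ (i, j)\<bar>) * (int n - 1)"
      by (simp only: sum_distrib_right)
    also have "\<dots> \<le> r * (int n - 1)"
      using n by (intro mult_right_mono row_sums i) simp
    finally have "\<bar>(B *\<^sub>v x) $ i\<bar> \<le> r * (int n - 1)" .
    moreover have "- r \<le> v $ i" "v $ i < r" using v i by (simp_all add: int_cube_def)
    ultimately have bounds: "- (int n * r) \<le> z" "z < int n * r"
      unfolding z by (simp_all add: algebra_simps abs_le_iff)
    have mod: "int n * (z div int n) + z mod int n = z" "0 \<le> z mod int n" "z mod int n < int n"
      using n by simp_all
    have "\<not> r \<le> z div int n"
    proof
      assume "r \<le> z div int n"
      then have "int n * r \<le> int n * (z div int n)" by (intro mult_left_mono) simp_all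
      with bounds mod show False by linarith
    qed
    moreover have "\<not> z div int n \<le> - r - 1"
    proof
      assume "z div int n \<le> - r - 1"
      then have "int n * (z div int n) \<le> int n * (- r - 1)" by (intro mult_left_mono) simp_all
      also have "\<dots> = - (int n * r) - int n" by (simp add: algebra_simps)
      finally show False using bounds mod by linarith
    qed
    ultimately show ?thesis by (simp add: z_def)
  qed
  then show ?thesis using B xv by (auto simp: int_cube_def)
qed

lemma step_carrier:
  assumes "q \<in> states A" "c \<in> letters"
  shows "B *\<^sub>v digit c + shift q \<in> carrier_vec d"
  using shift_carrier[OF assms(1)] digit_in_cube[OF assms(2)] mult_mat_vec_carrier[OF B]
  by (simp add: int_cube_def)

lemma digit_rewriting:
  assumes "q \<in> states A" "c \<in> letters"
  shows "digit (rewriting A q c) = map_vec (\<lambda>z. z mod int n) (B *\<^sub>v digit c + shift q)"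
  using digit_letter_of[OF remainder_in_cube[OF step_carrier[OF assms]]]
  by (simp add: affine_aut_def shift_def)

lemma rewriting_in_letters:
  assumes "q \<in> states A" "c \<in> letters"
  shows "rewriting A q c \<in> letters"
  using letter_of_in_letters[OF remainder_in_cube[OF step_carrier[OF assms]]]
  by (simp add: affine_aut_def shift_def)

lemma shift_transition:
  assumes "q \<in> states A" "c \<in> letters"
  shows "shift (transition A q c) = map_vec (\<lambda>z. z div int n) (B *\<^sub>v digit c + shift q)"
  using from_nat_into_to_nat_on_finite[OF finite_int_cube
      carry_in_cube[OF digit_in_cube[OF assms(2)] shift_in_cube[OF assms(1)]]]
  by (simp add: affine_aut_def shift_def)

lemma transition_in_states:
  assumes "q \<in> states A" "c \<in> letters"
  shows "transition A q c \<in> states A"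
  using to_nat_on_finite_less[OF finite_int_cube
      carry_in_cube[OF digit_in_cube[OF assms(2)] shift_in_cube[OF assms(1)]]]
  by (simp add: affine_aut_def shift_def)

lemma rewriting_inj:
  assumes q: "q \<in> states A" and bc: "b \<in> letters" "c \<in> letters"
    and eq: "rewriting A q b = rewriting A q c"
  shows "b = c"
proof (rule digit_inj[OF bc])
  note carriers = digit_in_cube[OF bc(1)] digit_in_cube[OF bc(2)]
  have db: "digit b \<in> carrier_vec d" and dc: "digit c \<in> carrier_vec d"
    using carriers by (simp_all add: int_cube_def)
  fix i assume i: "i < d"
  show "[digit b $ i = digit c $ i] (mod int n)"
  proof (rule cong_mult_mat_vec_cancel[OF B det_coprime db dc _ i])
    fix k assume k: "k < d"
    have "digit (rewriting A q b) $ k = digit (rewriting A q c) $ k" using eq by simp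
    then have "[(B *\<^sub>v digit b) $ k + shift q $ k = (B *\<^sub>v digit c) $ k + shift q $ k] (mod int n)"
      unfolding digit_rewriting[OF q bc(1)] digit_rewriting[OF q bc(2)] cong_def
      using B k shift_carrier[OF q] by simp
    then show "[(B *\<^sub>v digit b) $ k = (B *\<^sub>v digit c) $ k] (mod int n)"
      by (simp only: cong_add_rcancel)
  qed
qed

sublocale invertible_automaton A
proof
  show "finite (states A)" "finite (alphabet A)"
    by (simp_all add: affine_aut_def)
  show "rewriting A \<in> states A \<rightarrow> alphabet A \<rightarrow> alphabet A"
    using rewriting_in_letters by (simp add: alphabet_A Pi_def)
  show "transition A \<in> states A \<rightarrow> alphabet A \<rightarrow> states A"
    using transition_in_states by (simp add: alphabet_A Pi_def)
  fix q assume q: "q \<in> states A"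
  have "inj_on (rewriting A q) letters"
    using rewriting_inj[OF q] by (rule inj_onI)
  moreover have "rewriting A q ` letters \<subseteq> letters"
    using rewriting_in_letters[OF q] by (rule image_subsetI)
  ultimately show "bij_betw (rewriting A q) (alphabet A) (alphabet A)"
    unfolding alphabet_A bij_betw_def
    using endo_inj_surj[of letters "rewriting A q"] by simp
qed

text \<open>With z = B c + v, B (c + n y) + v = z mod n + n (B y + z div n). The linear part is thus
  the same after every letter and only the translation vector changes, which is why the latter alone
  serves as state.\<close>

lemma val_action:
  assumes "q \<in> states A" "w \<in> lists letters" "i < d"
  shows "[val (action A q w) $ i = (B *\<^sub>v val w + shift q) $ i] (mod int n ^ length w)"
  using assms(1,2)
proof (induction w arbitrary: q rule: list.induct)
  case (Cons c w)
  then have c: "c \<in> letters" and w: "w \<in> lists letters" by simp_all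
  note q = Cons.prems(1)
  define q' where "q' = transition A q c"
  define z where "z = (B *\<^sub>v digit c + shift q) $ i"
  have q': "q' \<in> states A"
    using transition_in_states[OF q c] by (simp add: q'_def)
  have dc: "digit c \<in> carrier_vec d" using digit_in_cube[OF c] by (simp add: int_cube_def)
  have dim: "dim_row B = d" "dim_vec (shift q) = d" "dim_vec (shift q') = d"
    using B shift_carrier q q' by auto
  have "action A q' w \<in> lists letters"
    using action_closed[OF q'] w by (simp only: alphabet_A)
  then have "val (action A q (c # w)) $ i = z mod int n + int n * val (action A q' w) $ i"
    unfolding action.simps val_Cons_index[OF rewriting_in_letters[OF q c] _ assms(3)]
      q'_def[symmetric] digit_rewriting[OF q c]
    using assms(3) dim
    by (subst val_Cons_index[OF rewriting_in_letters[OF q c] _ assms(3)])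
      (simp_all add: z_def digit_rewriting[OF q c])
  also have "[z mod int n + int n * val (action A q' w) $ i
      = z mod int n + int n * (B *\<^sub>v val w + shift q') $ i] (mod int n ^ length (c # w))"
    using Cons.IH[OF q' w] n
    by (intro cong_add cong_refl)
      (simp add: cong_iff_dvd_diff right_diff_distrib[symmetric] del: index_add_vec index_mult_mat_vec)
  also have "z mod int n + int n * (B *\<^sub>v val w + shift q') $ i = z + int n * (B *\<^sub>v val w) $ i"
  proof -
    have "shift q' $ i = z div int n"
      using assms(3) dim by (simp add: q'_def shift_transition[OF q c] z_def)
    moreover have "(B *\<^sub>v val w + shift q') $ i = (B *\<^sub>v val w) $ i + shift q' $ i"
      using assms(3) dim by (simp only: index_add_vec)
    moreover have "z mod int n + int n * (z div int n) = z" by simp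
    ultimately show ?thesis by (simp only: distrib_left)
  qed
  also have "z + int n * (B *\<^sub>v val w) $ i = (B *\<^sub>v val (c # w) + shift q) $ i"
  proof -
    have "z = (B *\<^sub>v digit c) $ i + shift q $ i"
      using assms(3) dim by (simp only: z_def index_add_vec)
    moreover have "(B *\<^sub>v val (c # w) + shift q) $ i = (B *\<^sub>v val (c # w)) $ i + shift q $ i"
      using assms(3) dim by (simp only: index_add_vec)
    moreover have "(B *\<^sub>v val (c # w)) $ i = (B *\<^sub>v digit c) $ i + int n * (B *\<^sub>v val w) $ i"
      unfolding index_mult_mat_vec_sum[OF B val_carrier[OF Cons.prems(2)] assms(3)]
        index_mult_mat_vec_sum[OF B dc assms(3)] index_mult_mat_vec_sum[OF B val_carrier[OF w] assms(3)]
      unfolding sum_distrib_left sum.distrib[symmetric]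
      by (intro sum.cong) (simp_all only: val_Cons_index[OF c w] lessThan_iff algebra_simps)
    ultimately show ?thesis by simp
  qed
  finally show ?case .
qed simp

lemma realizes_action:
  assumes "q \<in> states A"
  shows "realizes (restrict (action A q) (lists letters)) B (shift q)"
  using restrict_action_in_tree_Aut[OF assms] val_action[OF assms]
  by (simp add: realizes_def alphabet_A)

end

context digit_tree
begin

text \<open>The box is enlarged until it contains \<open>v\<close>, so that the map is a state of
  some automaton; bijectivity and compatibility with the tree are inherited from there.\<close>

lemma realizes_exists:
  assumes "B \<in> carrier_mat d d" "coprime (det B) (int n)" "v \<in> carrier_vec d"
  shows "\<exists>f. realizes f B v"
proof -
  \<comment> \<open>The final 1 makes the upper bound of the half-open box strict: \<bar>v_i\<bar> <
    r.\<close>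
  define r where "r = (\<Sum>i<d. \<Sum>j<d. \<bar>B $$ (i, j)\<bar>) + (\<Sum>i<d. \<bar>v $ i\<bar>) + 1"
  have le: "(\<Sum>j<d. \<bar>B $$ (i, j)\<bar>) \<le> (\<Sum>i<d. \<Sum>j<d. \<bar>B $$ (i, j)\<bar>)" "\<bar>v $ i\<bar> \<le> (\<Sum>i<d. \<bar>v $ i\<bar>)"
    if "i < d" for i
    using that member_le_sum[of i "{..<d}" "\<lambda>i. \<Sum>j<d. \<bar>B $$ (i, j)\<bar>"]
      member_le_sum[of i "{..<d}" "\<lambda>i. \<bar>v $ i\<bar>"] by (simp_all add: sum_nonneg)
  have nonneg: "0 \<le> (\<Sum>i<d. \<Sum>j<d. \<bar>B $$ (i, j)\<bar>)" "0 \<le> (\<Sum>i<d. \<bar>v $ i\<bar>)"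
    by (simp_all add: sum_nonneg)
  interpret affine_automaton d n B r
  proof
    show "(\<Sum>j<d. \<bar>B $$ (i, j)\<bar>) \<le> r" if "i < d" for i
      using le(1)[OF that] nonneg unfolding r_def by linarith
  qed (use assms in auto)
  have v: "v \<in> int_cube d (- r) r"
    using assms(3) le(2) nonneg by (fastforce simp: int_cube_def r_def abs_le_iff)
  define q where "q = to_nat_on (int_cube d (- r) r) v"
  have "q \<in> states A" "shift q = v"
    using to_nat_on_finite_less[OF finite_int_cube v] from_nat_into_to_nat_on_finite[OF finite_int_cube v]
    by (simp_all add: q_def shift_def affine_aut_def)
  with realizes_action[of q] show ?thesis by auto
qed

end

section \<open>The automaton group as a quotient of the HNN extension\<close>

lemma mult_mat_left_cancel:
  fixes A :: "'a :: idom mat"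
  assumes A: "A \<in> carrier_mat d d" "det A \<noteq> 0"
    and XY: "X \<in> carrier_mat d d" "Y \<in> carrier_mat d d" "A * X = A * Y"
  shows "X = Y"
proof -
  have "adj_mat A * (A * Z) = det A \<cdot>\<^sub>m Z" if Z: "Z \<in> carrier_mat d d" for Z
    unfolding assoc_mult_mat[OF adj_mat(1)[OF A(1)] A(1) Z, symmetric] adj_mat(3)[OF A(1)]
    using Z by (simp add: mult_smult_assoc_mat[OF one_carrier_mat Z])
  from this[OF XY(1)] this[OF XY(2)] have eq: "det A \<cdot>\<^sub>m X = det A \<cdot>\<^sub>m Y"
    by (simp only: XY(3))
  show ?thesis
  proof (rule eq_matI)
    fix i j assume "i < dim_row Y" "j < dim_col Y"
    then have ij: "i < d" "j < d" using XY by auto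
    have "(det A \<cdot>\<^sub>m X) $$ (i, j) = (det A \<cdot>\<^sub>m Y) $$ (i, j)" by (simp only: eq)
    then show "X $$ (i, j) = Y $$ (i, j)" using A(2) XY ij by simp
  qed (use XY in auto)
qed

lemma pow_mat_left_cancel:
  fixes A :: "'a :: idom mat"
  assumes A: "A \<in> carrier_mat d d" "det A \<noteq> 0"
    and "X \<in> carrier_mat d d" "Y \<in> carrier_mat d d" "A ^\<^sub>m p * X = A ^\<^sub>m p * Y"
  shows "X = Y"
  using assms(3-)
proof (induction p arbitrary: X Y)
  case 0
  then show ?case using A by simp
next
  case (Suc p)
  have "A * X \<in> carrier_mat d d" "A * Y \<in> carrier_mat d d" using A Suc.prems by auto
  moreover have "A ^\<^sub>m p * (A * X) = A ^\<^sub>m p * (A * Y)"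
    using Suc.prems(3) unfolding pow_mat.simps
    by (simp only: assoc_mult_mat[OF pow_carrier_mat[OF A(1)] A(1) Suc.prems(1)]
        assoc_mult_mat[OF pow_carrier_mat[OF A(1)] A(1) Suc.prems(2)])
  ultimately have "A * X = A * Y" by (rule Suc.IH)
  then show ?case by (rule mult_mat_left_cancel[OF A Suc.prems(1,2)])
qed

lemma pow_mat_add:
  assumes "A \<in> carrier_mat d d"
  shows "A ^\<^sub>m (p + k) = A ^\<^sub>m p * A ^\<^sub>m k"
proof (induction k)
  case 0
  then show ?case using assms by simp
next
  case (Suc k)
  then show ?case
    using assms
    by (simp add: assoc_mult_mat[OF pow_carrier_mat[OF assms] pow_carrier_mat[OF assms] assms])
qed

lemma (in group) power_prod_in_subgroup:
  assumes "subgroup H G" "a ` set js \<subseteq> H"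
  shows "power_prod G a u js \<in> H"
  using assms(2)
proof (induction js)
  case (Cons j js)
  then show ?case
    using assms(1) by (auto intro!: subgroup.m_closed subgroup_int_pow_closed)
qed (simp add: subgroup.one_closed[OF assms(1)])

section \<open>Multiplication of affine maps and powers of translations\<close>

context digit_tree
begin

abbreviation Tree where "Tree \<equiv> tree_Aut letters"

sublocale Tree: group Tree
  by (rule group_tree_Aut)

text \<open>Meaningful if \<open>det B\<close> is coprime to \<open>n\<close>:
  \<open>realizes_exists\<close> and \<open>realizes_unique\<close> then pin the value down.\<close>

definition affine_map :: "int mat \<Rightarrow> int vec \<Rightarrow> nat list \<Rightarrow> nat list" where
  "affine_map B v = (SOME f. realizes f B v)"

abbreviation translation :: "int vec \<Rightarrow> nat list \<Rightarrow> nat list" where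
  "translation \<equiv> affine_map (1\<^sub>m d)"

lemma affine_map_eq: "realizes f B v \<Longrightarrow> affine_map B v = f"
  unfolding affine_map_def by (rule some_equality) (auto intro: realizes_unique)

lemma realizes_affine_map:
  assumes "B \<in> carrier_mat d d" "coprime (det B) (int n)" "v \<in> carrier_vec d"
  shows "realizes (affine_map B v) B v"
  unfolding affine_map_def by (rule someI_ex[OF realizes_exists[OF assms]])

lemma affine_map_closed:
  assumes "B \<in> carrier_mat d d" "coprime (det B) (int n)" "v \<in> carrier_vec d"
  shows "affine_map B v \<in> carrier Tree"
  by (rule realizesD(1)[OF realizes_affine_map[OF assms]])

lemma affine_map_mult:
  assumes "B \<in> carrier_mat d d" "coprime (det B) (int n)" "v \<in> carrier_vec d"
    and "C \<in> carrier_mat d d" "coprime (det C) (int n)" "w \<in> carrier_vec d"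
  shows "affine_map B v \<otimes>\<^bsub>Tree\<^esub> affine_map C w = affine_map (B * C) (B *\<^sub>v w + v)"
  using assms by (intro affine_map_eq[symmetric] realizes_mult realizes_affine_map)

lemma realizes_translation: "v \<in> carrier_vec d \<Longrightarrow> realizes (translation v) (1\<^sub>m d) v"
  by (rule realizes_affine_map) simp_all

lemma translation_closed: "v \<in> carrier_vec d \<Longrightarrow> translation v \<in> carrier Tree"
  by (rule affine_map_closed) simp_all

lemma translation_mult_affine_map:
  assumes "v \<in> carrier_vec d" "B \<in> carrier_mat d d" "coprime (det B) (int n)" "w \<in> carrier_vec d"
  shows "translation v \<otimes>\<^bsub>Tree\<^esub> affine_map B w = affine_map B (v + w)"
  using affine_map_mult[OF one_carrier_mat _ assms] assms by (simp add: comm_add_vec[of v d w])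

lemma translation_add:
  assumes "v \<in> carrier_vec d" "w \<in> carrier_vec d"
  shows "translation (v + w) = translation v \<otimes>\<^bsub>Tree\<^esub> translation w"
  using assms by (simp add: translation_mult_affine_map)

text \<open>0 + 0 = 0 makes this element idempotent, and a group has only one idempotent.\<close>

lemma translation_zero: "translation (0\<^sub>v d) = \<one>\<^bsub>Tree\<^esub>"
  using translation_add[of "0\<^sub>v d" "0\<^sub>v d"] translation_closed[of "0\<^sub>v d"] by simp

lemma translation_nat_pow:
  assumes "v \<in> carrier_vec d"
  shows "translation v [^]\<^bsub>Tree\<^esub> k = translation (int k \<cdot>\<^sub>v v)"
proof (induction k)
  case 0
  have "0 \<cdot>\<^sub>v v = 0\<^sub>v d" using assms by auto
  then show ?case by (simp add: translation_zero)
next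
  case (Suc k)
  have "int (Suc k) \<cdot>\<^sub>v v = int k \<cdot>\<^sub>v v + v"
    using assms by (intro eq_vecI) (simp_all add: algebra_simps)
  then show ?case using Suc assms by (simp add: translation_add)
qed

lemma translation_int_pow:
  assumes v: "v \<in> carrier_vec d"
  shows "translation v [^]\<^bsub>Tree\<^esub> (k :: int) = translation (k \<cdot>\<^sub>v v)"
proof (cases k)
  case (nonneg m)
  then show ?thesis using translation_nat_pow[OF v] by (simp add: int_pow_int)
next
  case (neg m)
  have "k \<cdot>\<^sub>v v + int (Suc m) \<cdot>\<^sub>v v = 0\<^sub>v d"
    unfolding neg using v by (intro eq_vecI) (simp_all add: algebra_simps)
  with translation_add[of "k \<cdot>\<^sub>v v" "int (Suc m) \<cdot>\<^sub>v v"] v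
  have "translation (k \<cdot>\<^sub>v v) \<otimes>\<^bsub>Tree\<^esub> translation (int (Suc m) \<cdot>\<^sub>v v) = \<one>\<^bsub>Tree\<^esub>"
    by (simp only: translation_zero smult_carrier_vec)
  then have "inv\<^bsub>Tree\<^esub> translation (int (Suc m) \<cdot>\<^sub>v v) = translation (k \<cdot>\<^sub>v v)"
    using v by (intro Tree.inv_equality translation_closed smult_carrier_vec[THEN iffD2])
  then show ?thesis
    unfolding neg Tree.int_pow_neg_int[OF translation_closed[OF v]] translation_nat_pow[OF v] .
qed

text \<open>Arbitrary lists keep the induction free of side conditions: repeated indices add up, and
  for an index j beyond the range \<open>unit_vec d j\<close> is the zero vector.\<close>

lemma power_prod_translation:
  "power_prod Tree (\<lambda>j. translation (unit_vec d j)) u js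
    = translation (vec d (\<lambda>i. \<Sum>j\<leftarrow>js. if i = j then u j else 0))"
proof (induction js)
  case Nil
  have "vec d (\<lambda>i. \<Sum>j\<leftarrow>[]. if i = j then u j else 0) = 0\<^sub>v d" by auto
  then show ?case by (simp add: translation_zero)
next
  case (Cons j js)
  have "vec d (\<lambda>i. \<Sum>j\<leftarrow>j # js. if i = j then u j else 0)
      = u j \<cdot>\<^sub>v unit_vec d j + vec d (\<lambda>i. \<Sum>j\<leftarrow>js. if i = j then u j else 0)"
    by (intro eq_vecI) (simp_all add: unit_vec_def)
  then show ?case
    by (simp only: power_prod.simps Cons.IH translation_int_pow unit_vec_carrier translation_add
        smult_carrier_vec vec_carrier)
qed

lemma power_prod_translation_upt:
  "power_prod Tree (\<lambda>j. translation (unit_vec d j)) u [0..<d] = translation (vec d u)"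
proof -
  have "vec d (\<lambda>i. \<Sum>j\<leftarrow>[0..<d]. if i = j then u j else 0) = vec d u"
    by (intro eq_vecI) (simp_all add: interv_sum_list_conv_sum_set_nat)
  then show ?thesis by (simp only: power_prod_translation)
qed

end

section \<open>The action of the HNN extension on the tree and its kernel\<close>

locale hnn_digit_tree = digit_tree +
  fixes M :: "int mat"
  assumes M: "M \<in> carrier_mat d d" and coprime: "coprime (det M) (int n)"
    and infinite_order: "k \<ge> 1 \<Longrightarrow> M ^\<^sub>m k \<noteq> 1\<^sub>m d"
begin

lemma pow_mat_inj:
  assumes "M ^\<^sub>m p = M ^\<^sub>m q"
  shows "p = q"
proof -
  \<comment> \<open>A zero determinant would be coprime to n only for n = 1.\<close>
  have det: "det M \<noteq> 0" using coprime n by auto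
  have False if eq: "M ^\<^sub>m p = M ^\<^sub>m q" and "p < q" for p q :: nat
  proof -
    from \<open>p < q\<close> have q: "q = p + (q - p)" "q - p \<ge> 1" by simp_all
    have "M ^\<^sub>m p * M ^\<^sub>m (q - p) = M ^\<^sub>m q"
      by (simp only: pow_mat_add[OF M, symmetric] q(1)[symmetric])
    also have "\<dots> = M ^\<^sub>m p * 1\<^sub>m d"
      by (simp only: right_mult_one_mat[OF pow_carrier_mat[OF M]] eq)
    finally have "M ^\<^sub>m p * M ^\<^sub>m (q - p) = M ^\<^sub>m p * 1\<^sub>m d" .
    then have "M ^\<^sub>m (q - p) = 1\<^sub>m d"
      by (rule pow_mat_left_cancel[OF M det pow_carrier_mat[OF M] one_carrier_mat])
    then show False using infinite_order q(2) by blast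
  qed
  from this[OF assms] this[OF assms[symmetric]] show ?thesis
    by (cases p q rule: linorder_cases) blast+
qed

definition gen_map :: "hnn_gen \<Rightarrow> nat list \<Rightarrow> nat list" where
  "gen_map s = (case s of Base i \<Rightarrow> translation (unit_vec d i) | Stable \<Rightarrow> affine_map M (0\<^sub>v d))"

lemma gen_map_simps [simp]:
  "gen_map (Base i) = translation (unit_vec d i)" "gen_map Stable = affine_map M (0\<^sub>v d)"
  by (simp_all add: gen_map_def)

lemma stable_closed: "affine_map M (0\<^sub>v d) \<in> carrier Tree"
  by (rule affine_map_closed[OF M coprime zero_carrier_vec])

lemma gen_map_closed: "gen_map \<in> hnn_gens d \<rightarrow> carrier Tree"
  using stable_closed by (auto simp: hnn_gens_def intro!: translation_closed)

lemma stable_translation: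
  assumes v: "v \<in> carrier_vec d"
  shows "affine_map M (0\<^sub>v d) \<otimes>\<^bsub>Tree\<^esub> translation v
    = translation (M *\<^sub>v v) \<otimes>\<^bsub>Tree\<^esub> affine_map M (0\<^sub>v d)"
proof -
  have "M *\<^sub>v v \<in> carrier_vec d" using M v by simp
  then show ?thesis
    using affine_map_mult[OF M coprime zero_carrier_vec one_carrier_mat _ v] M
    by (simp add: translation_mult_affine_map coprime)
qed

sublocale Tree: hnn_target Tree d M gen_map
proof
  show "gen_map \<in> hnn_gens d \<rightarrow> carrier Tree" by (rule gen_map_closed)
  show "M \<in> carrier_mat d d" by (rule M)
  fix l r assume "(l, r) \<in> hnn_relations d M"
  then consider i j where "i < d" "j < d"
      "l = [(Base i, True), (Base j, True)]" "r = [(Base j, True), (Base i, True)]"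
    | i where "i < d" "l = [(Stable, True), (Base i, True), (Stable, False)]"
      "r = concat (map (\<lambda>j. gen_power (Base j) (M $$ (j, i))) [0..<d])"
    by (auto simp: hnn_relations_def)
  then show "word_value Tree gen_map l = word_value Tree gen_map r"
  proof cases
    case 1
    then show ?thesis
      by (simp add: translation_closed translation_add[symmetric] comm_add_vec[of _ d])
  next
    case 2
    have "word_value Tree gen_map r = translation (vec d (\<lambda>j. M $$ (j, i)))"
      unfolding 2 by (subst Tree.word_value_concat_gen_power[OF gen_map_closed])
        (auto simp: hnn_gens_def power_prod_translation_upt)
    \<comment> \<open>The exponents of the relation run down column i, which is the image of the
      i-th unit vector; so the relation is the conjugation rule for this vector.\<close>
    also have "vec d (\<lambda>j. M $$ (j, i)) = M *\<^sub>v unit_vec d i"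
      using M 2(1) by (intro eq_vecI) auto
    finally have r: "word_value Tree gen_map r = translation (M *\<^sub>v unit_vec d i)" .
    have closed: "translation (unit_vec d i) \<in> carrier Tree"
        "translation (M *\<^sub>v unit_vec d i) \<in> carrier Tree"
      using M by (auto intro!: translation_closed)
    have "word_value Tree gen_map l = affine_map M (0\<^sub>v d) \<otimes>\<^bsub>Tree\<^esub> translation (unit_vec d i)
        \<otimes>\<^bsub>Tree\<^esub> inv\<^bsub>Tree\<^esub> affine_map M (0\<^sub>v d)"
      using stable_closed closed by (simp add: 2 Tree.m_assoc)
    also have "\<dots> = translation (M *\<^sub>v unit_vec d i)"
      unfolding stable_translation[OF unit_vec_carrier]
      using stable_closed closed by (simp add: Tree.m_assoc)
    finally show ?thesis by (simp only: r)
  qed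
qed

lemma base_elt_eq_translation:
  assumes "v \<in> carrier_vec d"
  shows "Tree.base_elt v = translation v"
proof -
  have "vec d (($) v) = v" using assms by (intro eq_vecI) auto
  then show ?thesis by (simp add: Tree.base_elt_def power_prod_translation_upt)
qed

lemma realizes_stable_pow: "realizes (affine_map M (0\<^sub>v d) [^]\<^bsub>Tree\<^esub> q) (M ^\<^sub>m q) (0\<^sub>v d)"
proof (induction q)
  case 0
  then show ?case
    using realizes_translation[of "0\<^sub>v d"] M by (simp add: translation_zero)
next
  case (Suc q)
  have "M ^\<^sub>m q *\<^sub>v 0\<^sub>v d + 0\<^sub>v d = 0\<^sub>v d"
    using M by (intro eq_vecI) auto
  with realizes_mult[OF pow_carrier_mat[OF M] M zero_carrier_vec zero_carrier_vec Suc
      realizes_affine_map[OF M coprime zero_carrier_vec]]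
  show ?case by simp
qed

text \<open>Both sides are affine maps, with parameters (M^q, v) and (M^p, 0). Comparing these gives
  v = 0 and equal powers of M, and infinite order gives q = p.\<close>

lemma translation_stable_pow_eq:
  fixes p q :: nat
  assumes v: "v \<in> carrier_vec d"
    and eq: "translation v \<otimes>\<^bsub>Tree\<^esub> affine_map M (0\<^sub>v d) [^]\<^bsub>Tree\<^esub> q = affine_map M (0\<^sub>v d) [^]\<^bsub>Tree\<^esub> p"
  shows "v = 0\<^sub>v d \<and> q = p"
proof -
  have "realizes (translation v \<otimes>\<^bsub>Tree\<^esub> affine_map M (0\<^sub>v d) [^]\<^bsub>Tree\<^esub> q) (M ^\<^sub>m q) v"
    using realizes_mult[OF one_carrier_mat pow_carrier_mat[OF M] v zero_carrier_vec
        realizes_translation[OF v] realizes_stable_pow] M v by simp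
  from realizes_determines[OF pow_carrier_mat[OF M] pow_carrier_mat[OF M] v zero_carrier_vec
      this[unfolded eq] realizes_stable_pow]
  show ?thesis using pow_mat_inj by simp
qed

abbreviation HNN where "HNN \<equiv> presented_group (hnn_gens d) (hnn_relations d M)"

abbreviation hnn_class where "hnn_class s \<equiv> word_class (hnn_gens d) (hnn_relations d M) [(s, True)]"

text \<open>The presented group satisfies its own relations, so the normal form applies to every
  element of G_M.\<close>

sublocale HNN: hnn_target HNN d M hnn_class
proof -
  interpret group HNN by (rule group_presented_group)
  show "hnn_target HNN d M hnn_class"
  proof
    show "hnn_class \<in> hnn_gens d \<rightarrow> carrier HNN" by (auto intro!: word_class_closed)
    show "M \<in> carrier_mat d d" by (rule M)
    fix l r assume lr: "(l, r) \<in> hnn_relations d M"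
    then have "l \<in> words (hnn_gens d)" "r \<in> words (hnn_gens d)" using hnn_relations_words by auto
    then show "word_value HNN hnn_class l = word_value HNN hnn_class r"
      using word_cong.relation[OF lr, of "hnn_gens d" "[]" "[]"]
      by (simp add: word_value_presented_group word_class_eq_iff)
  qed
qed

abbreviation hnn_action where
  "hnn_action \<equiv> presented_hom (hnn_gens d) Tree gen_map"

lemma hnn_action_kernel:
  assumes C: "C \<in> carrier HNN" and triv: "hnn_action C = \<one>\<^bsub>Tree\<^esub>"
  shows "C = \<one>\<^bsub>HNN\<^esub>"
proof -
  interpret H: group_hom HNN Tree hnn_action
    by (intro group_hom.intro group_hom_axioms.intro HNN.is_group Tree.is_group Tree.presented_hom_hom)
  have gen: "hnn_action (hnn_class s) = gen_map s" if "s \<in> hnn_gens d" for s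
    using that Tree.presented_hom_class[of "[(s, True)]"] gen_map_closed by (auto simp: Pi_iff)
  have stable: "hnn_action (hnn_class Stable) = affine_map M (0\<^sub>v d)"
    by (subst gen) (simp_all add: hnn_gens_def)
  have base: "hnn_action (HNN.base_elt v) = translation v" if "v \<in> carrier_vec d" for v
  proof -
    have "hnn_action (HNN.base_elt v)
        = power_prod Tree (\<lambda>j. hnn_action (hnn_class (Base j))) (($) v) [0..<d]"
      unfolding HNN.base_elt_def
      by (rule power_prod_hom[OF HNN.is_group Tree.is_group Tree.presented_hom_hom HNN.Base_closed'])
    also have "\<dots> = Tree.base_elt v"
      unfolding Tree.base_elt_def
      by (rule power_prod_cong) (simp, subst gen, simp_all add: hnn_gens_def)
    finally show ?thesis by (simp only: base_elt_eq_translation[OF that])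
  qed
  obtain w where w: "w \<in> words (hnn_gens d)" "C = word_value HNN hnn_class w"
    using C by (auto simp: carrier_presented_group word_value_presented_group)
  from HNN.word_value_normal_form[OF w(1)] obtain p q :: nat and v
    where v: "v \<in> carrier_vec d"
      and nf: "C = inv\<^bsub>HNN\<^esub> (hnn_class Stable [^]\<^bsub>HNN\<^esub> p) \<otimes>\<^bsub>HNN\<^esub>
        (HNN.base_elt v \<otimes>\<^bsub>HNN\<^esub> hnn_class Stable [^]\<^bsub>HNN\<^esub> q)"
    unfolding w(2) by blast
  note closed = HNN.t_closed HNN.base_elt_closed
  have "hnn_action C = inv\<^bsub>Tree\<^esub> (affine_map M (0\<^sub>v d) [^]\<^bsub>Tree\<^esub> p) \<otimes>\<^bsub>Tree\<^esub>
      (translation v \<otimes>\<^bsub>Tree\<^esub> affine_map M (0\<^sub>v d) [^]\<^bsub>Tree\<^esub> q)"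
    unfolding nf using closed by (simp add: H.hom_nat_pow stable base[OF v])
  then have "inv\<^bsub>Tree\<^esub> (affine_map M (0\<^sub>v d) [^]\<^bsub>Tree\<^esub> p) \<otimes>\<^bsub>Tree\<^esub>
      (translation v \<otimes>\<^bsub>Tree\<^esub> affine_map M (0\<^sub>v d) [^]\<^bsub>Tree\<^esub> q) = \<one>\<^bsub>Tree\<^esub>"
    using triv by simp
  \<comment> \<open>Clearing t^-p leaves nonnegative powers of t on both sides, so that both are
    affine maps with integer parameters.\<close>
  then have "translation v \<otimes>\<^bsub>Tree\<^esub> affine_map M (0\<^sub>v d) [^]\<^bsub>Tree\<^esub> q
      = affine_map M (0\<^sub>v d) [^]\<^bsub>Tree\<^esub> p"
    using stable_closed translation_closed[OF v]
      Tree.inv_solve_left'[of "\<one>\<^bsub>Tree\<^esub>" "affine_map M (0\<^sub>v d) [^]\<^bsub>Tree\<^esub> p"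
        "translation v \<otimes>\<^bsub>Tree\<^esub> affine_map M (0\<^sub>v d) [^]\<^bsub>Tree\<^esub> q"]
    by simp
  from translation_stable_pow_eq[OF v this] show ?thesis
    unfolding nf using closed by (simp add: HNN.base_elt_zero)
qed

lemma hnn_group_iso: "hnn_group d M \<cong> Tree\<lparr>carrier := generate Tree (gen_map ` hnn_gens d)\<rparr>"
  unfolding hnn_group_def by (rule Tree.presented_group_iso[OF hnn_action_kernel])

text \<open>The map with parameter v is the translation by v after t. Conversely t is the map with
  parameter 0, and dividing the map with parameter e_i by it on the right leaves a_i.\<close>

lemma generate_affine_maps:
  assumes "V \<subseteq> carrier_vec d" "0\<^sub>v d \<in> V" "\<And>i. i < d \<Longrightarrow> unit_vec d i \<in> V"
  shows "generate Tree (affine_map M ` V) = generate Tree (gen_map ` hnn_gens d)"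
proof
  have gens: "gen_map ` hnn_gens d \<subseteq> carrier Tree" using gen_map_closed by auto
  have maps: "affine_map M ` V \<subseteq> carrier Tree"
    using assms(1) affine_map_closed[OF M coprime] by auto
  have split: "affine_map M v = translation v \<otimes>\<^bsub>Tree\<^esub> affine_map M (0\<^sub>v d)" if "v \<in> carrier_vec d" for v
    using that translation_mult_affine_map[OF that M coprime zero_carrier_vec] by simp
  have H: "subgroup (generate Tree (gen_map ` hnn_gens d)) Tree"
    by (rule Tree.generate_is_subgroup[OF gens])
  show "generate Tree (affine_map M ` V) \<subseteq> generate Tree (gen_map ` hnn_gens d)"
  proof (rule Tree.generate_subgroup_incl[OF image_subsetI H])
    fix v assume "v \<in> V"
    then have v: "v \<in> carrier_vec d" using assms(1) by auto
    have "gen_map (Base j) \<in> generate Tree (gen_map ` hnn_gens d)" if "j < d" for j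
      using that by (intro generate.incl imageI) (simp add: hnn_gens_def)
    then have "Tree.base_elt v \<in> generate Tree (gen_map ` hnn_gens d)"
      unfolding Tree.base_elt_def by (intro Tree.power_prod_in_subgroup[OF H] image_subsetI) simp
    moreover have "gen_map Stable \<in> generate Tree (gen_map ` hnn_gens d)"
      by (intro generate.incl imageI) (simp add: hnn_gens_def)
    ultimately show "affine_map M v \<in> generate Tree (gen_map ` hnn_gens d)"
      unfolding split[OF v] base_elt_eq_translation[OF v] gen_map_simps by (rule generate.eng)
  qed
  have K: "subgroup (generate Tree (affine_map M ` V)) Tree"
    by (rule Tree.generate_is_subgroup[OF maps])
  show "generate Tree (gen_map ` hnn_gens d) \<subseteq> generate Tree (affine_map M ` V)"
  proof (rule Tree.generate_subgroup_incl[OF image_subsetI K])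
    fix s assume "s \<in> hnn_gens d"
    then consider "s = Stable" | i where "s = Base i" "i < d" by (auto simp: hnn_gens_def)
    then show "gen_map s \<in> generate Tree (affine_map M ` V)"
    proof cases
      case 1
      then show ?thesis using assms(2) by (auto intro: generate.incl)
    next
      case 2
      have "translation (unit_vec d i)
          = affine_map M (unit_vec d i) \<otimes>\<^bsub>Tree\<^esub> inv\<^bsub>Tree\<^esub> affine_map M (0\<^sub>v d)"
        using split[OF unit_vec_carrier, of i] stable_closed translation_closed[OF unit_vec_carrier, of i]
        by (simp add: Tree.m_assoc)
      also have "\<dots> \<in> generate Tree (affine_map M ` V)"
        using assms(2) assms(3)[OF 2(2)] by (intro generate.eng generate.incl generate.inv imageI)
      finally show ?thesis by (simp add: 2)
    qed
  qed
qed

lemma automaton_group_iso_hnn_group: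
  assumes "affine_automaton d n M r" "r \<ge> 2"
  shows "automaton_group (affine_aut M r) \<cong> hnn_group d M"
proof -
  interpret affine_automaton d n M r by (rule assms(1))
  let ?V = "int_cube d (- r) r"
  have "restrict (action A q) (lists letters) = affine_map M (shift q)" if "q \<in> states A" for q
    by (rule affine_map_eq[OF realizes_action[OF that], symmetric])
  then have "(\<lambda>q. restrict (action A q) (lists letters)) ` states A = affine_map M ` shift ` states A"
    unfolding image_image by (rule image_cong[OF HOL.refl])
  also have "shift ` states A = ?V"
    using bij_betw_from_nat_into_finite[OF finite_int_cube, of d "- r" r]
    by (simp add: bij_betw_def shift_def affine_aut_def)
  finally have acts: "(\<lambda>q. restrict (action A q) (lists letters)) ` states A = affine_map M ` ?V" .
  have V: "?V \<subseteq> carrier_vec d" by (auto simp: int_cube_def)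
  \<comment> \<open>\<open>subgroup_generated\<close> intersects its generators with the carrier;
    here this loses nothing.\<close>
  then have "carrier Tree \<inter> affine_map M ` ?V = affine_map M ` ?V"
    using affine_map_closed[OF M coprime] by auto
  then have "automaton_group A = Tree\<lparr>carrier := generate Tree (affine_map M ` ?V)\<rparr>"
    unfolding automaton_group_def alphabet_A acts subgroup_generated_def by simp
  also have "generate Tree (affine_map M ` ?V) = generate Tree (gen_map ` hnn_gens d)"
    \<comment> \<open>With \<open>r \<ge> 2\<close> the entry 1 lies strictly below the upper end of
      the box, which therefore contains the unit vectors.\<close>
    using assms(2) V by (intro generate_affine_maps) (auto simp: int_cube_def)
  finally have "automaton_group A = Tree\<lparr>carrier := generate Tree (gen_map ` hnn_gens d)\<rparr>" .
  then have "hnn_group d M \<cong> automaton_group A" using hnn_group_iso by simp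
  then show ?thesis
    using group.iso_sym group_presented_group unfolding hnn_group_def by blast
qed

end

theorem proposition4:
  fixes d n :: nat and M :: "int mat"
  assumes "d \<ge> 1" and "n \<ge> 2"
    and "M \<in> carrier_mat d d"
    and "\<forall>k\<ge>1. M ^\<^sub>m k \<noteq> 1\<^sub>m d"
    and "coprime (det M) (int n)"
  shows "\<exists>A :: (nat, nat) automaton.
    invertible_automaton A \<and> card (alphabet A) = n ^ d \<and> automaton_group A \<cong> hnn_group d M"
proof -
  \<comment> \<open>The sum of all absolute values bounds every row sum at once; the summand 2
    guarantees \<open>r \<ge> 2\<close>, so that the box contains the unit vectors.\<close>
  define r where "r = (\<Sum>i<d. \<Sum>j<d. \<bar>M $$ (i, j)\<bar>) + 2"
  interpret hnn_digit_tree d n M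
    using assms by unfold_locales auto
  have aut: "affine_automaton d n M r"
  proof
    fix i assume "i < d"
    then show "(\<Sum>j<d. \<bar>M $$ (i, j)\<bar>) \<le> r"
      using member_le_sum[of i "{..<d}" "\<lambda>i. \<Sum>j<d. \<bar>M $$ (i, j)\<bar>"]
      by (simp add: r_def sum_nonneg)
  qed (use assms in auto)
  interpret affine_automaton d n M r by (rule aut)
  have "r \<ge> 2" by (simp add: r_def sum_nonneg)
  from automaton_group_iso_hnn_group[OF aut this] show ?thesis
    using invertible_automaton_axioms alphabet_A by (intro exI[of _ A]) simp
qed

end
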